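(* Let $f(\cdot;W)$ be an $L$-layer ReLU network ($\phi(z)=\max(z,0)$) with input dimension $d$ and $k$ outputs, let $S=\{x^1,\dots,x^n\}\subset\mathbb{R}^d$ be a dataset, and let $1\le q\le 2$. Let $\mathscr{V}_q$, $\zeta_q$ and $p^{(q)}$ be the $q$-path variation, $q$-path complexity and $q$-path distribution of $f(\cdot;W)$ with respect to $S$. Let $M\ge 1$ be an integer, and let $\tilde p$ be the empirical Markov distribution formed from $M$ independent samples of paths $(j_0,j_1,\dots,j_L)$ from $p^{(q)}$. Put $f(x;\widetilde W)=\mathscr{V}_q f(x;\tilde p)$. Then $$\mathbb{E}_{\tilde p}\Big[\frac1n\sum_{x\in S}\|f(x;\widetilde W)-f(x;W)\|_2^2\Big]\le\Big(\frac{\mathscr{V}_q\,\zeta_q\,L}{\sqrt M}\Big)^2 .$$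
   Context: **Networks.** An $L$-layer network with layer widths $d_0=d,d_1,\dots,d_{L-1},d_L=k$ and weight matrices $W_\ell\in\mathbb{R}^{d_\ell\times d_{\ell-1}}$, $W_\ell[j_\ell,j_{\ell-1}]=w_{j_\ell,j_{\ell-1}}$, is $f(x;W)=W_L\phi(W_{L-1}\phi(\cdots\phi(W_1x)))$ with $\phi$ applied coordinatewise (no activation on the output layer). Sign convention: by doubling the units of each layer (and duplicating input coordinates with both signs) every network can be rewritten with nonnegative weights, where each hidden unit applies either $+\phi$ or $-\phi$. All networks are taken in this form: $w_{j_\ell,j_{\ell-1}}\ge0$, and at each hidden unit the symbol $\phi$ stands for a fixed choice of $+\phi$ or $-\phi$; the $d_\ell$ are the widths in this form. **Path quantities.** A path is a tuple $(j_0,\dots,j_L)$ with $1\le j_\ell\le d_\ell$; its weight is $w_{j_0,\dots,j_L}=w_{j_L,j_{L-1}}w_{j_{L-1},j_{L-2}}\cdots w_{j_1,j_0}$. For $1\le q\le\infty$ with conjugate exponent $q^*$ ($1/q+1/q^*=1$), set $w^{(q)}_{j_0}=\big(n^{-1}\sum_{x\in S}|x_{j_0}|^{q^*}\big)^{1/q^*}$ if $q>1$ and $w^{(1)}_{j_0}=\max_{x\in S}|x_{j_0}|$. The $q$-path variation is $\mathscr{V}_q=\sum_{j_0,\dots,j_L}w^{(q)}_{j_0}w_{j_0,\dots,j_L}$ (assumed positive so that one can normalize), and the $q$-path distribution is $p^{(q)}_{j_0,\dots,j_L}=w^{(q)}_{j_0}w_{j_0,\dots,j_L}/\mathscr{V}_q$.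 It is Markov: $p_{j_0,\dots,j_L}=p_{j_L}p_{j_{L-1}|j_L}\cdots p_{j_0|j_1}$. With $p^{(q)}_\ell$ the marginal law of $j_\ell$ and $H_{1/2}(r)=2\log\sum_j\sqrt{r_j}$ the Rényi entropy of order $1/2$, the $q$-path complexity is $\zeta_q=\frac1L\big(1+\sum_{\ell=1}^{L-1}e^{\frac12H_{1/2}(p^{(q)}_\ell)}\big)$. **Network of a Markov path distribution.** For a Markov path distribution $r$ (such as $p^{(q)}$ or $\tilde p$ below), $f(x;r)=R_L\phi(R_{L-1}\phi(\cdots\phi(R_1x')))$, where $R_\ell[j_\ell,j_{\ell-1}]=r_{j_{\ell-1}|j_\ell}$ for $\ell<L$, $R_L[j_L,j_{L-1}]=r_{j_L,j_{L-1}}$, $x'_{j_0}=x_{j_0}/w^{(q)}_{j_0}$ (with $0/0=0$), and hidden units carry the same signs as in the original network. By positive homogeneity $f(x;W)=\mathscr{V}_qf(x;p^{(q)})$ for $x\in S$. **Sampling.** Draw $M$ i.i.d. paths from $p^{(q)}$; $K_{j_0,\dots,j_L}$ is the number of times a path occurs, and $K_{j_\ell}$, $K_{j_\ell,j_{\ell+1}}$ are the marginal and consecutive-pair counts. Set $\tilde p_{j_\ell}=K_{j_\ell}/M$, $\tilde p_{j_\ell,j_{\ell+1}}=K_{j_\ell,j_{\ell+1}}/M$, $\tilde p_{j_\ell|j_{\ell+1}}=\tilde p_{j_\ell,j_{\ell+1}}/\tilde p_{j_{\ell+1}}$ (with $0/0=0$). The empirical Markov distribution is $\tilde p_{j_0,\dots,j_L}=\tilde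 p_{j_L}\tilde p_{j_{L-1}|j_L}\cdots\tilde p_{j_0|j_1}$. *)

theory Defs
  imports "HOL-Probability.Probability"
begin

text \<open>
  Layer \<open>l \<le> L\<close> has the units \<open>{1..d l}\<close>, and \<open>W l j i\<close> is the weight from unit \<open>i\<close> of layer
  \<open>l - 1\<close> to unit \<open>j\<close> of layer \<open>l\<close>. Networks are in the sign-normalised form: the weights are
  nonnegative and the hidden unit \<open>j\<close> of layer \<open>l\<close> applies \<open>s l j\<close> times the ReLU, where
  \<open>s l j\<close> is \<open>1\<close> or \<open>- 1\<close>. A dataset of size \<open>n\<close> is a family \<open>x 1, \<dots>, x n\<close> of vectors; the
  coordinates of \<open>x m\<close> are \<open>x m j\<close> for \<open>j\<close> in \<open>{1..d 0}\<close>.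
\<close>

definition relu :: "real \<Rightarrow> real" where
  "relu z = max z 0"

fun hidden ::
  "(nat \<Rightarrow> nat) \<Rightarrow> (nat \<Rightarrow> nat \<Rightarrow> real) \<Rightarrow> (nat \<Rightarrow> nat \<Rightarrow> nat \<Rightarrow> real) \<Rightarrow> (nat \<Rightarrow> real)
    \<Rightarrow> nat \<Rightarrow> nat \<Rightarrow> real" where
  "hidden d s W v 0 j = v j"
| "hidden d s W v (Suc l) j = s (Suc l) j * relu (\<Sum>i = 1..d l. W (Suc l) j i * hidden d s W v l i)"

definition network ::
  "nat \<Rightarrow> (nat \<Rightarrow> nat) \<Rightarrow> (nat \<Rightarrow> nat \<Rightarrow> real) \<Rightarrow> (nat \<Rightarrow> nat \<Rightarrow> nat \<Rightarrow> real) \<Rightarrow> (nat \<Rightarrow> real)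
    \<Rightarrow> nat \<Rightarrow> real" where
  "network L d s W v j = (\<Sum>i = 1..d (L - 1). W L j i * hidden d s W v (L - 1) i)"


definition paths :: "nat \<Rightarrow> (nat \<Rightarrow> nat) \<Rightarrow> (nat \<Rightarrow> nat) set" where
  "paths L d = (\<Pi>\<^sub>E l\<in>{0..L}. {1..d l})"

definition path_weight :: "nat \<Rightarrow> (nat \<Rightarrow> nat \<Rightarrow> nat \<Rightarrow> real) \<Rightarrow> (nat \<Rightarrow> nat) \<Rightarrow> real" where
  "path_weight L W \<pi> = (\<Prod>l = 1..L. W l (\<pi> l) (\<pi> (l - 1)))"

text \<open>The conjugate exponent of \<open>q > 1\<close> is \<open>q / (q - 1)\<close>.\<close>

definition input_weight :: "real \<Rightarrow> nat \<Rightarrow> (nat \<Rightarrow> nat \<Rightarrow> real) \<Rightarrow> nat \<Rightarrow> real" where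
  "input_weight q n x j =
    (if q = 1 then Max ((\<lambda>m. \<bar>x m j\<bar>) ` {1..n})
     else let q' = q / (q - 1) in ((1 / real n) * (\<Sum>m = 1..n. \<bar>x m j\<bar> powr q')) powr (1 / q'))"

definition path_variation ::
  "nat \<Rightarrow> (nat \<Rightarrow> nat) \<Rightarrow> (nat \<Rightarrow> nat \<Rightarrow> nat \<Rightarrow> real) \<Rightarrow> real \<Rightarrow> nat \<Rightarrow> (nat \<Rightarrow> nat \<Rightarrow> real) \<Rightarrow> real"
  where
  "path_variation L d W q n x =
    (\<Sum>\<pi>\<in>paths L d. input_weight q n x (\<pi> 0) * path_weight L W \<pi>)"

text \<open>Distributions on paths are represented by their mass functions, extended by zero.\<close>

definition path_prob ::
  "nat \<Rightarrow> (nat \<Rightarrow> nat) \<Rightarrow> (nat \<Rightarrow> nat \<Rightarrow> nat \<Rightarrow> real) \<Rightarrow> real \<Rightarrow> nat \<Rightarrow> (nat \<Rightarrow> nat \<Rightarrow> real)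
    \<Rightarrow> (nat \<Rightarrow> nat) \<Rightarrow> real" where
  "path_prob L d W q n x \<pi> =
    (if \<pi> \<in> paths L d
     then input_weight q n x (\<pi> 0) * path_weight L W \<pi> / path_variation L d W q n x else 0)"

definition path_pmf ::
  "nat \<Rightarrow> (nat \<Rightarrow> nat) \<Rightarrow> (nat \<Rightarrow> nat \<Rightarrow> nat \<Rightarrow> real) \<Rightarrow> real \<Rightarrow> nat \<Rightarrow> (nat \<Rightarrow> nat \<Rightarrow> real)
    \<Rightarrow> (nat \<Rightarrow> nat) pmf" where
  "path_pmf L d W q n x = embed_pmf (path_prob L d W q n x)"

definition marginal ::
  "nat \<Rightarrow> (nat \<Rightarrow> nat) \<Rightarrow> ((nat \<Rightarrow> nat) \<Rightarrow> real) \<Rightarrow> nat \<Rightarrow> nat \<Rightarrow> real" where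
  "marginal L d r l j = (\<Sum>\<pi> | \<pi> \<in> paths L d \<and> \<pi> l = j. r \<pi>)"

text \<open>For \<open>l \<ge> 1\<close>: the joint law of the units \<open>i\<close> of layer \<open>l - 1\<close> and \<open>j\<close> of layer \<open>l\<close>, and the
  conditional law of \<open>i\<close> given \<open>j\<close>.\<close>

definition pair_marginal ::
  "nat \<Rightarrow> (nat \<Rightarrow> nat) \<Rightarrow> ((nat \<Rightarrow> nat) \<Rightarrow> real) \<Rightarrow> nat \<Rightarrow> nat \<Rightarrow> nat \<Rightarrow> real" where
  "pair_marginal L d r l j i = (\<Sum>\<pi> | \<pi> \<in> paths L d \<and> \<pi> (l - 1) = i \<and> \<pi> l = j. r \<pi>)"

definition conditional ::
  "nat \<Rightarrow> (nat \<Rightarrow> nat) \<Rightarrow> ((nat \<Rightarrow> nat) \<Rightarrow> real) \<Rightarrow> nat \<Rightarrow> nat \<Rightarrow> nat \<Rightarrow> real" where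
  "conditional L d r l j i = pair_marginal L d r l j i / marginal L d r l j"

definition renyi_half :: "nat set \<Rightarrow> (nat \<Rightarrow> real) \<Rightarrow> real" where
  "renyi_half J r = 2 * ln (\<Sum>j\<in>J. sqrt (r j))"

definition path_complexity ::
  "nat \<Rightarrow> (nat \<Rightarrow> nat) \<Rightarrow> (nat \<Rightarrow> nat \<Rightarrow> nat \<Rightarrow> real) \<Rightarrow> real \<Rightarrow> nat \<Rightarrow> (nat \<Rightarrow> nat \<Rightarrow> real) \<Rightarrow> real"
  where
  "path_complexity L d W q n x =
    (1 / real L) * (1 + (\<Sum>l = 1..L - 1.
      exp (1 / 2 * renyi_half {1..d l} (marginal L d (path_prob L d W q n x) l))))"


definition dist_weights ::
  "nat \<Rightarrow> (nat \<Rightarrow> nat) \<Rightarrow> ((nat \<Rightarrow> nat) \<Rightarrow> real) \<Rightarrow> nat \<Rightarrow> nat \<Rightarrow> nat \<Rightarrow> real" where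
  "dist_weights L d r l j i =
    (if l < L then conditional L d r l j i else pair_marginal L d r l j i)"

text \<open>\<open>f(v; r)\<close> for a Markov path distribution \<open>r\<close> and \<open>u\<close> the input weights of the dataset.\<close>

definition dist_network ::
  "nat \<Rightarrow> (nat \<Rightarrow> nat) \<Rightarrow> (nat \<Rightarrow> nat \<Rightarrow> real) \<Rightarrow> (nat \<Rightarrow> real) \<Rightarrow> ((nat \<Rightarrow> nat) \<Rightarrow> real) \<Rightarrow> (nat \<Rightarrow> real)
    \<Rightarrow> nat \<Rightarrow> real" where
  "dist_network L d s u r v = network L d s (dist_weights L d r) (\<lambda>i. v i / u i)"


text \<open>\<open>M\<close> independent paths \<open>\<omega> 1, \<dots>, \<omega> M\<close>; the value of \<open>\<omega>\<close> outside \<open>{1..M}\<close> is irrelevant.\<close>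

definition path_samples ::
  "nat \<Rightarrow> (nat \<Rightarrow> nat) \<Rightarrow> (nat \<Rightarrow> nat \<Rightarrow> nat \<Rightarrow> real) \<Rightarrow> real \<Rightarrow> nat \<Rightarrow> (nat \<Rightarrow> nat \<Rightarrow> real) \<Rightarrow> nat
    \<Rightarrow> (nat \<Rightarrow> nat \<Rightarrow> nat) pmf" where
  "path_samples L d W q n x M = Pi_pmf {1..M} undefined (\<lambda>_. path_pmf L d W q n x)"

definition emp_marginal :: "nat \<Rightarrow> (nat \<Rightarrow> nat \<Rightarrow> nat) \<Rightarrow> nat \<Rightarrow> nat \<Rightarrow> real" where
  "emp_marginal M \<omega> l j = real (card {m \<in> {1..M}. \<omega> m l = j}) / real M"

definition emp_pair :: "nat \<Rightarrow> (nat \<Rightarrow> nat \<Rightarrow> nat) \<Rightarrow> nat \<Rightarrow> nat \<Rightarrow> nat \<Rightarrow> real" where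
  "emp_pair M \<omega> l j i = real (card {m \<in> {1..M}. \<omega> m (l - 1) = i \<and> \<omega> m l = j}) / real M"

definition emp_conditional :: "nat \<Rightarrow> (nat \<Rightarrow> nat \<Rightarrow> nat) \<Rightarrow> nat \<Rightarrow> nat \<Rightarrow> nat \<Rightarrow> real" where
  "emp_conditional M \<omega> l j i = emp_pair M \<omega> l j i / emp_marginal M \<omega> l j"

definition emp_markov ::
  "nat \<Rightarrow> (nat \<Rightarrow> nat) \<Rightarrow> nat \<Rightarrow> (nat \<Rightarrow> nat \<Rightarrow> nat) \<Rightarrow> (nat \<Rightarrow> nat) \<Rightarrow> real" where
  "emp_markov L d M \<omega> \<pi> =
    (if \<pi> \<in> paths L d
     then emp_marginal M \<omega> L (\<pi> L) * (\<Prod>l = 1..L. emp_conditional M \<omega> l (\<pi> l) (\<pi> (l - 1)))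
     else 0)"


text \<open>Under the standing assumptions \<open>path_pmf\<close> really has the mass function \<open>path_prob\<close>.\<close>

lemma input_weight_nonneg:
  assumes "1 \<le> n" shows "0 \<le> input_weight q n x j"
proof -
  have "0 \<le> \<bar>x 1 j\<bar>" by simp
  also have "\<dots> \<le> Max ((\<lambda>m. \<bar>x m j\<bar>) ` {1..n})"
    using assms by (intro Max_ge) auto
  finally show ?thesis by (auto simp: input_weight_def Let_def)
qed

lemma path_weight_nonneg:
  assumes "\<forall>l\<in>{1..L}. \<forall>j\<in>{1..d l}. \<forall>i\<in>{1..d (l - 1)}. 0 \<le> W l j i" and "\<pi> \<in> paths L d"
  shows "0 \<le> path_weight L W \<pi>"
  unfolding path_weight_def
proof (rule prod_nonneg)
  fix l assume l: "l \<in> {1..L}"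
  then have "l \<in> {0..L}" "l - 1 \<in> {0..L}" by auto
  then have "\<pi> l \<in> {1..d l}" "\<pi> (l - 1) \<in> {1..d (l - 1)}"
    using assms(2) unfolding paths_def by (blast dest: PiE_mem)+
  with assms(1) l show "0 \<le> W l (\<pi> l) (\<pi> (l - 1))" by blast
qed

lemma finite_paths [simp]: "finite (paths L d)"
  unfolding paths_def by (intro finite_PiE) auto

lemma pmf_path_pmf:
  assumes "1 \<le> n"
    and "\<forall>l\<in>{1..L}. \<forall>j\<in>{1..d l}. \<forall>i\<in>{1..d (l - 1)}. 0 \<le> W l j i"
    and "0 < path_variation L d W q n x"
  shows "pmf (path_pmf L d W q n x) \<pi> = path_prob L d W q n x \<pi>"
proof -
  let ?p = "path_prob L d W q n x"
  have nn: "0 \<le> ?p \<pi>" for \<pi>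
    using assms by (auto simp: path_prob_def input_weight_nonneg path_weight_nonneg)
  have "(\<integral>\<^sup>+ \<pi>. ennreal (?p \<pi>) \<partial>count_space UNIV) = (\<integral>\<^sup>+ \<pi>. ennreal (?p \<pi>) \<partial>count_space (paths L d))"
    by (rule nn_integral_count_space_eq) (auto simp: path_prob_def)
  also have "\<dots> = (\<Sum>\<pi>\<in>paths L d. ennreal (?p \<pi>))"
    by (rule nn_integral_count_space_finite) simp
  also have "\<dots> = ennreal (\<Sum>\<pi>\<in>paths L d. ?p \<pi>)"
    by (rule sum_ennreal) (rule nn)
  also have "(\<Sum>\<pi>\<in>paths L d. ?p \<pi>)
      = (\<Sum>\<pi>\<in>paths L d. input_weight q n x (\<pi> 0) * path_weight L W \<pi> / path_variation L d W q n x)"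
    by (rule sum.cong) (simp_all add: path_prob_def)
  also have "\<dots> = path_variation L d W q n x / path_variation L d W q n x"
    by (simp add: path_variation_def flip: sum_divide_distrib)
  finally have "(\<integral>\<^sup>+ \<pi>. ennreal (?p \<pi>) \<partial>count_space UNIV) = 1"
    using assms(3) by simp
  then show ?thesis
    unfolding path_pmf_def by (intro pmf_embed_pmf nn)
qed

end

theory Submission
  imports Defs
begin

text \<open>
  Sampling paths replaces the path distribution \<open>p\<close> by the empirical law \<open>p'\<close> of the sampled
  paths, and both networks are \<open>f(\<cdot>; r)\<close> for a law \<open>r\<close> on paths. Let \<open>h\<close> and \<open>h'\<close> be their hidden
  values. As \<open>p'\<close> has consistent marginals and the activations are 1-Lipschitz, the weighted error
  \<open>e l = (\<Sum>j. p' l j * \<bar>h' l j - h l j\<bar>)\<close> grows from one layer to the next by at most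
  \<open>(\<Sum>j. \<bar>D l j\<bar>)\<close>, where \<open>D l j\<close> is the sample mean of the centred variable that equals
  \<open>h (l - 1) i - E[h (l - 1) i | j]\<close> if the sampled path goes through the unit \<open>i\<close> of layer
  \<open>l - 1\<close> and the unit \<open>j\<close> of layer \<open>l\<close>, and \<open>0\<close> otherwise. The output layer adds the deviation
  of a sample mean of vectors. For \<open>q \<le> 2\<close> the normalised inputs have mean square at most \<open>1\<close> over
  the dataset, hence so have all hidden values, and the mean square of \<open>D l j\<close> is at most
  \<open>p l j / M\<close>. By Minkowski's inequality the total error is at most
  \<open>(1 + (\<Sum>l j. sqrt (p l j))) / sqrt M\<close>, and the sum over \<open>j\<close> is the exponential of half
  the Renyi entropy.
\<close>

subsection \<open>Factorisation of path sums\<close>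

lemma sum_paths_Suc:
  "sum F (paths (Suc l) d) = (\<Sum>\<pi>\<in>paths l d. \<Sum>j = 1..d (Suc l). F (\<pi>(Suc l := j)))"
proof -
  have "{0..Suc l} = insert (Suc l) {0..l}" by auto
  then have "paths (Suc l) d = (\<lambda>(j, \<pi>). \<pi>(Suc l := j)) ` ({1..d (Suc l)} \<times> paths l d)"
    unfolding paths_def by (simp add: PiE_insert_eq)
  moreover have "inj_on (\<lambda>(j, \<pi>). \<pi>(Suc l := j)) ({1..d (Suc l)} \<times> paths l d)"
    unfolding paths_def using inj_combinator[of "Suc l" "{0..l}" "\<lambda>l. {1..d l}"] by simp
  ultimately have "sum F (paths (Suc l) d)
      = (\<Sum>(j, \<pi>)\<in>{1..d (Suc l)} \<times> paths l d. F (\<pi>(Suc l := j)))"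
    by (simp add: sum.reindex case_prod_unfold)
  also have "\<dots> = (\<Sum>\<pi>\<in>paths l d. \<Sum>j = 1..d (Suc l). F (\<pi>(Suc l := j)))"
    by (subst sum.swap) (simp add: sum.cartesian_product)
  finally show ?thesis .
qed

lemma paths_0: "paths 0 d = (\<lambda>j. (\<lambda>_. undefined)(0 := j)) ` {1..d 0}"
  using PiE_insert_eq[of 0 "{}" "\<lambda>l. {1..d l}"] by (auto simp: paths_def)

lemma paths_range: "\<pi> \<in> paths L d \<Longrightarrow> l \<le> L \<Longrightarrow> \<pi> l \<in> {1..d l}"
  unfolding paths_def by (auto dest: PiE_mem)

lemma path_weight_Suc:
  "path_weight (Suc l) W (\<pi>(Suc l := j)) = path_weight l W \<pi> * W (Suc l) j (\<pi> l)"
proof -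
  have "(\<Prod>m = 1..l. W m ((\<pi>(Suc l := j)) m) ((\<pi>(Suc l := j)) (m - 1))) = path_weight l W \<pi>"
    unfolding path_weight_def by (rule prod.cong) auto
  then show ?thesis unfolding path_weight_def by simp
qed

text \<open>The total weight of the paths that end in unit \<open>j\<close> of layer
  \<open>l\<close>, with the start of each path weighted by \<open>u\<close>.\<close>

fun mass :: "(nat \<Rightarrow> nat) \<Rightarrow> (nat \<Rightarrow> nat \<Rightarrow> nat \<Rightarrow> real) \<Rightarrow> (nat \<Rightarrow> real) \<Rightarrow> nat \<Rightarrow> nat \<Rightarrow> real" where
  "mass d W u 0 j = u j"
| "mass d W u (Suc l) j = (\<Sum>i = 1..d l. W (Suc l) j i * mass d W u l i)"

text \<open>\<open>comass d W k l i\<close> is the total weight of the paths that lead from unit \<open>i\<close> of layer \<open>l\<close>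
  to layer \<open>l + k\<close>.\<close>

fun comass :: "(nat \<Rightarrow> nat) \<Rightarrow> (nat \<Rightarrow> nat \<Rightarrow> nat \<Rightarrow> real) \<Rightarrow> nat \<Rightarrow> nat \<Rightarrow> nat \<Rightarrow> real" where
  "comass d W 0 l i = 1"
| "comass d W (Suc k) l i = (\<Sum>j = 1..d (Suc l). W (Suc l) j i * comass d W k (Suc l) j)"

text \<open>Induction on the depth with an arbitrary function \<open>f\<close> of the endpoint:
  summing out the last unit replaces \<open>f\<close> by a weighted sum over that layer, which
  depends only on the unit before.\<close>

lemma sum_paths_mass:
  "(\<Sum>\<pi>\<in>paths l d. u (\<pi> 0) * path_weight l W \<pi> * f (\<pi> l)) = (\<Sum>j = 1..d l. mass d W u l j * f j)"
proof (induction l arbitrary: f)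
  case 0
  have "inj_on (\<lambda>j. (\<lambda>_. undefined)(0 := j)) {1..d 0}"
    by (auto simp: inj_on_def dest: fun_cong[where x = 0])
  then have "(\<Sum>\<pi>\<in>paths 0 d. u (\<pi> 0) * f (\<pi> 0)) = (\<Sum>j = 1..d 0. u j * f j)"
    unfolding paths_0 by (subst sum.reindex) auto
  then show ?case by (simp add: path_weight_def)
next
  case (Suc l)
  have "(\<Sum>\<pi>\<in>paths (Suc l) d. u (\<pi> 0) * path_weight (Suc l) W \<pi> * f (\<pi> (Suc l)))
      = (\<Sum>\<pi>\<in>paths l d. u (\<pi> 0) * path_weight l W \<pi> * (\<Sum>j = 1..d (Suc l). W (Suc l) j (\<pi> l) * f j))"
    by (simp add: sum_paths_Suc path_weight_Suc sum_distrib_left mult.assoc)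
  also have "\<dots> = (\<Sum>i = 1..d l. \<Sum>j = 1..d (Suc l). mass d W u l i * (W (Suc l) j i * f j))"
    using Suc[of "\<lambda>i. \<Sum>j = 1..d (Suc l). W (Suc l) j i * f j"] by (simp add: sum_distrib_left)
  also have "\<dots> = (\<Sum>j = 1..d (Suc l). mass d W u (Suc l) j * f j)"
    by (subst sum.swap) (simp add: sum_distrib_right mult.assoc mult.left_commute)
  finally show ?case .
qed

text \<open>The hypothesis says that \<open>F\<close> sees only the units up to layer
  \<open>l\<close>, so the later units can be summed out. The induction moves the first later weight
  into \<open>F\<close>, hence it varies both \<open>l\<close> and \<open>F\<close>.\<close>

lemma sum_paths_comass:
  assumes "\<And>\<pi> \<pi>'. (\<And>i. i \<le> l \<Longrightarrow> \<pi> i = \<pi>' i) \<Longrightarrow> F \<pi> = F \<pi>'"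
  shows "(\<Sum>\<pi>\<in>paths (l + k) d. F \<pi> * (\<Prod>i = Suc l..l + k. W i (\<pi> i) (\<pi> (i - 1))))
    = (\<Sum>\<pi>\<in>paths l d. F \<pi> * comass d W k l (\<pi> l))"
  using assms
proof (induction k arbitrary: l F)
  case 0
  show ?case by simp
next
  case (Suc k)
  define G where "G \<pi> = F \<pi> * W (Suc l) (\<pi> (Suc l)) (\<pi> l)" for \<pi>
  have G: "G \<pi> = G \<pi>'" if "\<And>i. i \<le> Suc l \<Longrightarrow> \<pi> i = \<pi>' i" for \<pi> \<pi>'
  proof -
    have "F \<pi> = F \<pi>'" by (rule Suc.prems) (simp add: that)
    then show ?thesis by (simp add: G_def that)
  qed
  have upd: "F (\<pi>(Suc l := j)) = F \<pi>" for \<pi> j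
    by (rule Suc.prems) simp
  have split: "prod f {Suc l..l + Suc k} = f (Suc l) * prod f {Suc (Suc l)..Suc l + k}"
    for f :: "nat \<Rightarrow> real"
    using prod.atLeast_Suc_atMost[of "Suc l" "l + Suc k" f] by (simp del: prod.cl_ivl_Suc)
  have "(\<Sum>\<pi>\<in>paths (l + Suc k) d. F \<pi> * (\<Prod>i = Suc l..l + Suc k. W i (\<pi> i) (\<pi> (i - 1))))
      = (\<Sum>\<pi>\<in>paths (Suc l + k) d. G \<pi> * (\<Prod>i = Suc (Suc l)..Suc l + k. W i (\<pi> i) (\<pi> (i - 1))))"
    unfolding split by (simp add: G_def mult.assoc)
  also have "\<dots> = (\<Sum>\<pi>\<in>paths (Suc l) d. G \<pi> * comass d W k (Suc l) (\<pi> (Suc l)))"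
    using G by (rule Suc.IH)
  also have "\<dots> = (\<Sum>\<pi>\<in>paths l d. F \<pi> * comass d W (Suc k) l (\<pi> l))"
    by (simp add: sum_paths_Suc G_def upd sum_distrib_left mult.assoc)
  finally show ?case .
qed

text \<open>Fixing the units of two adjacent layers cuts a path into the part below, the edge and
  the part above, which vary independently. Summing them gives the mass, the weight and the
  comass.\<close>

lemma pair_marginal_path_weight:
  assumes r: "\<And>\<pi>. \<pi> \<in> paths L d \<Longrightarrow> r \<pi> = u (\<pi> 0) * path_weight L W \<pi> / c"
    and l: "1 \<le> l" "l \<le> L" and j: "j \<in> {1..d l}" and i: "i \<in> {1..d (l - 1)}"
  shows "pair_marginal L d r l j i = mass d W u (l - 1) i * W l j i * comass d W (L - l) l j / c"
proof -
  obtain l' where l': "l = Suc l'" using l by (cases l) auto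
  \<comment> \<open>The part of the summand up to layer \<open>l\<close>, with an indicator for the
    two prescribed units. The layers above \<open>l\<close> are summed out first, then layer
    \<open>l\<close>, then the layers below.\<close>
  define F where
    "F \<pi> = u (\<pi> 0) * path_weight l W \<pi> * of_bool (\<pi> (l - 1) = i \<and> \<pi> l = j)" for \<pi>
  have F: "F \<pi> = F \<pi>'" if eq: "\<And>m. m \<le> l \<Longrightarrow> \<pi> m = \<pi>' m" for \<pi> \<pi>'
  proof -
    have "path_weight l W \<pi> = path_weight l W \<pi>'"
      unfolding path_weight_def by (rule prod.cong) (auto simp: eq)
    then show ?thesis by (simp add: F_def eq)
  qed
  let ?Q = "\<lambda>\<pi>. \<Prod>m = Suc l..l + (L - l). W m (\<pi> m) (\<pi> (m - 1))"
  have pw: "path_weight L W \<pi> = path_weight l W \<pi> * ?Q \<pi>" for \<pi>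
    unfolding path_weight_def using prod.ub_add_nat[of 1 l _ "L - l"] l by simp
  have "pair_marginal L d r l j i
      = (\<Sum>\<pi>\<in>paths L d. if \<pi> (l - 1) = i \<and> \<pi> l = j then r \<pi> else 0)"
    unfolding pair_marginal_def by (rule sum.inter_filter) simp
  also have "\<dots> = (\<Sum>\<pi>\<in>paths L d. F \<pi> * ?Q \<pi> / c)"
    by (rule sum.cong[OF refl], subst r) (auto simp: F_def pw)
  also have "\<dots> = (\<Sum>\<pi>\<in>paths (l + (L - l)) d. F \<pi> * ?Q \<pi>) / c"
    using l by (simp add: sum_divide_distrib)
  also have "\<dots> = (\<Sum>\<pi>\<in>paths l d. F \<pi> * comass d W (L - l) l (\<pi> l)) / c"
    by (simp only: sum_paths_comass[of l F, OF F])
  also have "(\<Sum>\<pi>\<in>paths l d. F \<pi> * comass d W (L - l) l (\<pi> l))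
      = (\<Sum>\<pi>\<in>paths l' d. u (\<pi> 0) * path_weight l' W \<pi> *
           (of_bool (\<pi> l' = i) * (W l j i * comass d W (L - l) l j)))"
    unfolding l' sum_paths_Suc
  proof (rule sum.cong)
    fix \<pi> assume "\<pi> \<in> paths l' d"
    have "(\<Sum>j' = 1..d (Suc l'). F (\<pi>(Suc l' := j')) * comass d W (L - Suc l') (Suc l') ((\<pi>(Suc l' := j')) (Suc l')))
      = (\<Sum>j' = 1..d (Suc l'). if j' = j then u (\<pi> 0) * path_weight l' W \<pi> *
           (of_bool (\<pi> l' = i) * (W (Suc l') j i * comass d W (L - Suc l') (Suc l') j)) else 0)"
      by (rule sum.cong) (auto simp: F_def l' path_weight_Suc)
    then show "(\<Sum>j' = 1..d (Suc l'). F (\<pi>(Suc l' := j')) * comass d W (L - Suc l') (Suc l') ((\<pi>(Suc l' := j')) (Suc l')))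
      = u (\<pi> 0) * path_weight l' W \<pi> *
           (of_bool (\<pi> l' = i) * (W (Suc l') j i * comass d W (L - Suc l') (Suc l') j))"
      using j by (simp add: l')
  qed simp
  also have "\<dots> = (\<Sum>i' = 1..d l'. if i' = i then mass d W u l' i' * (W l j i * comass d W (L - l) l j) else 0)"
    unfolding sum_paths_mass[where f = "\<lambda>i'. of_bool (i' = i) * (W l j i * comass d W (L - l) l j)"]
    by (rule sum.cong) auto
  also have "\<dots> = mass d W u l' i * W l j i * comass d W (L - l) l j"
    using i l' by simp
  finally show ?thesis by (simp add: l')
qed

lemma marginal_eq_sum_pair_marginal:
  assumes "1 \<le> l" "l \<le> L"
  shows "marginal L d r l j = (\<Sum>i = 1..d (l - 1). pair_marginal L d r l j i)"
proof -
  have "(\<Sum>i = 1..d (l - 1). pair_marginal L d r l j i)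
      = (\<Sum>i = 1..d (l - 1). sum r {\<pi> \<in> {\<pi> \<in> paths L d. \<pi> l = j}. \<pi> (l - 1) = i})"
    unfolding pair_marginal_def by (intro sum.cong) (auto intro!: arg_cong[of _ _ "sum r"])
  also have "\<dots> = marginal L d r l j"
    unfolding marginal_def
    by (rule sum.group) (use assms paths_range[of _ L d "l - 1"] in auto)
  finally show ?thesis by simp
qed

lemma mass_nonneg:
  assumes "\<forall>l\<in>{1..L}. \<forall>j\<in>{1..d l}. \<forall>i\<in>{1..d (l - 1)}. 0 \<le> W l j i"
    and "\<And>i. i \<in> {1..d 0} \<Longrightarrow> 0 \<le> u i" and "l \<le> L" "j \<in> {1..d l}"
  shows "0 \<le> mass d W u l j"
  using assms(3,4)
proof (induction l arbitrary: j)
  case (Suc l)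
  have "0 \<le> W (Suc l) j i" if "i \<in> {1..d l}" for i
    using assms(1)[rule_format, of "Suc l" j i] Suc.prems that by auto
  then show ?case using Suc by (auto intro!: sum_nonneg)
qed (use assms in auto)

lemma comass_nonneg:
  assumes "\<forall>l\<in>{1..L}. \<forall>j\<in>{1..d l}. \<forall>i\<in>{1..d (l - 1)}. 0 \<le> W l j i"
    and "l + k \<le> L" "i \<in> {1..d l}"
  shows "0 \<le> comass d W k l i"
  using assms(2,3)
proof (induction k arbitrary: l i)
  case (Suc k)
  have "0 \<le> W (Suc l) j i" if "j \<in> {1..d (Suc l)}" for j
    using assms(1)[rule_format, of "Suc l" j i] Suc.prems that by auto
  then show ?case using Suc by (auto intro!: sum_nonneg)
qed auto

section \<open>Positive homogeneity and renormalised weights\<close>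

lemma relu_mult: "0 \<le> c \<Longrightarrow> relu (c * y) = c * relu y"
  by (cases "0 \<le> y") (auto simp: relu_def max_def mult_le_0_iff zero_le_mult_iff)

text \<open>Positive homogeneity moves the masses through the activations; units with comass \<open>0\<close> do not
  influence the output, and only for the others are the two hidden values proportional.\<close>

lemma network_dist_weights:
  assumes L: "1 \<le> L"
    and W: "\<forall>l\<in>{1..L}. \<forall>j\<in>{1..d l}. \<forall>i\<in>{1..d (l - 1)}. 0 \<le> W l j i"
    and u: "\<And>i. i \<in> {1..d 0} \<Longrightarrow> 0 \<le> u i"
    and v: "\<And>i. i \<in> {1..d 0} \<Longrightarrow> u i = 0 \<Longrightarrow> v i = 0"
    and c: "c \<noteq> 0"
    and r: "\<And>\<pi>. \<pi> \<in> paths L d \<Longrightarrow> r \<pi> = u (\<pi> 0) * path_weight L W \<pi> / c"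
    and j: "j \<in> {1..d L}"
  shows "c * network L d s (dist_weights L d r) (\<lambda>i. v i / u i) j = network L d s W v j"
proof -
  let ?a = "mass d W u" and ?b = "\<lambda>l. comass d W (L - l) l"
  let ?h = "hidden d s (dist_weights L d r) (\<lambda>i. v i / u i)"
  have pair: "pair_marginal L d r l j i = ?a (l - 1) i * W l j i * ?b l j / c"
    if "1 \<le> l" "l \<le> L" "j \<in> {1..d l}" "i \<in> {1..d (l - 1)}" for l j i
    using r that by (rule pair_marginal_path_weight)
  \<comment> \<open>A nonzero weight into a unit of positive comass gives its source a positive
    comass too, since the comass of the source is a sum of nonnegative terms containing that one. A
    zero weight kills both sides.\<close>
  have hid: "W (Suc l) j i * (?a l i * ?h l i) = W (Suc l) j i * hidden d s W v l i"
    if IH: "\<And>i. i \<in> {1..d l} \<Longrightarrow> ?b l i \<noteq> 0 \<Longrightarrow> ?a l i * ?h l i = hidden d s W v l i"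
      and l: "Suc l \<le> L" and ij: "i \<in> {1..d l}" "j \<in> {1..d (Suc l)}" "?b (Suc l) j \<noteq> 0" for l i j
  proof (cases "W (Suc l) j i = 0")
    case False
    have nn: "0 \<le> W (Suc l) j' i * ?b (Suc l) j'" if "j' \<in> {1..d (Suc l)}" for j'
      using W[rule_format, of "Suc l" j' i] that ij l
        comass_nonneg[OF W, of "Suc l" "L - Suc l" j'] by simp
    have "L - l = Suc (L - Suc l)" using l by simp
    then have "?b l i = (\<Sum>j' = 1..d (Suc l). W (Suc l) j' i * ?b (Suc l) j')" by simp
    also have "\<dots> \<ge> W (Suc l) j i * ?b (Suc l) j"
      using ij nn by (intro member_le_sum) auto
    finally have "W (Suc l) j i * ?b (Suc l) j \<le> ?b l i" .
    moreover have "W (Suc l) j i * ?b (Suc l) j \<noteq> 0" using False ij(3) by simp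
    ultimately have "?b l i \<noteq> 0" using nn[OF ij(2)] by linarith
    then show ?thesis using IH ij by simp
  qed simp
  have main: "?a l j * ?h l j = hidden d s W v l j"
    if "l < L" "j \<in> {1..d l}" "?b l j \<noteq> 0" for l j
    using that
  proof (induction l arbitrary: j)
    case 0
    then show ?case using v by auto
  next
    case (Suc l)
    have marg: "marginal L d r (Suc l) j = ?a (Suc l) j * ?b (Suc l) j / c"
    proof -
      have "marginal L d r (Suc l) j = (\<Sum>i = 1..d l. W (Suc l) j i * ?a l i * (?b (Suc l) j / c))"
        using Suc.prems
        by (simp add: marginal_eq_sum_pair_marginal pair mult.commute[of "?a l _"])
      then show ?thesis by (simp add: sum_distrib_right sum_divide_distrib)
    qed
    have nn: "0 \<le> ?a (Suc l) j"
      using mass_nonneg[OF W, of u "Suc l" j] u Suc.prems by (simp del: mass.simps)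
    have nn_terms: "0 \<le> W (Suc l) j i * ?a l i" if "i \<in> {1..d l}" for i
      using mass_nonneg[OF W, of u l i] u Suc.prems that W[rule_format, of "Suc l" j i] by simp
    \<comment> \<open>If the mass of unit \<open>j\<close> vanishes, so does each nonnegative term
      of the sum defining it; this covers the quotient 0/0 in the conditional law.\<close>
    have cond: "?a (Suc l) j * conditional L d r (Suc l) j i = W (Suc l) j i * ?a l i"
      if "i \<in> {1..d l}" for i
    proof (cases "?a (Suc l) j = 0")
      case True
      then have "W (Suc l) j i * ?a l i \<le> 0"
        using member_le_sum[of i "{1..d l}" "\<lambda>i. W (Suc l) j i * ?a l i"] nn_terms that by simp
      with nn_terms[OF that] have "W (Suc l) j i * ?a l i = 0" by simp
      with True show ?thesis by simp
    next
      case False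
      then show ?thesis
        using c Suc.prems that by (simp add: conditional_def marg pair del: mass.simps)
    qed
    have "?a (Suc l) j * (\<Sum>i = 1..d l. dist_weights L d r (Suc l) j i * ?h l i)
        = (\<Sum>i = 1..d l. (?a (Suc l) j * conditional L d r (Suc l) j i) * ?h l i)"
      using Suc.prems by (simp add: dist_weights_def sum_distrib_left mult.assoc del: mass.simps)
    also have "\<dots> = (\<Sum>i = 1..d l. W (Suc l) j i * hidden d s W v l i)"
      using hid[of l _ j] Suc by (intro sum.cong) (simp_all add: cond mult.assoc del: mass.simps)
    finally show ?case
      by (simp add: relu_mult[OF nn, symmetric] mult.left_commute del: mass.simps)
  qed
  obtain l where l: "L = Suc l" using L by (cases L) auto
  \<comment> \<open>At the output layer the comass is 1 and the weights are pair marginals, so no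
    marginal is divided by and \<open>c\<close> cancels.\<close>
  have "c * network L d s (dist_weights L d r) (\<lambda>i. v i / u i) j
      = (\<Sum>i = 1..d l. W L j i * (?a l i * ?h l i))"
    using pair[of L j] j c L
    by (simp add: network_def dist_weights_def sum_distrib_left l mult_ac)
  also have "\<dots> = network L d s W v j"
    unfolding network_def l using hid[of l _ j] main[of l] j
    by (intro sum.cong) (simp_all add: l)
  finally show ?thesis .
qed

subsection \<open>Moments of independent samples\<close>

lemma finite_set_Pi_pmf:
  "finite A \<Longrightarrow> (\<And>k. k \<in> A \<Longrightarrow> finite (set_pmf (p k))) \<Longrightarrow> finite (set_pmf (Pi_pmf A dflt p))"
  by (simp add: set_Pi_pmf finite_PiE_dflt)

lemma expectation_Pi_pmf_insert:
  fixes f :: "('a \<Rightarrow> 'b) \<Rightarrow> real"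
  assumes "finite A" "k \<notin> A" "finite (set_pmf p)"
  shows "measure_pmf.expectation (Pi_pmf (insert k A) dflt (\<lambda>_. p)) f
    = measure_pmf.expectation p (\<lambda>y. measure_pmf.expectation (Pi_pmf A dflt (\<lambda>_. p)) (\<lambda>\<omega>. f (fun_upd \<omega> k y)))"
  using assms
  by (simp add: Pi_pmf_insert' pmf_expectation_bind[where A = "set_pmf p"] finite_set_Pi_pmf
      integral_measure_pmf[where A = "set_pmf p"] flip: map_pmf_def)

text \<open>Both moments are proved in one induction, since the step for the second needs the first:
  the cross term \<open>2 * g y * S \<omega>\<close> vanishes because \<open>S\<close> has mean
  0.\<close>

lemma expectation_sum_Pi_pmf:
  fixes g :: "'b \<Rightarrow> real"
  assumes "finite A" "finite (set_pmf p)" and g: "measure_pmf.expectation p g = 0"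
  shows "measure_pmf.expectation (Pi_pmf A dflt (\<lambda>_. p)) (\<lambda>\<omega>. \<Sum>k\<in>A. g (\<omega> k)) = 0"
    and "measure_pmf.expectation (Pi_pmf A dflt (\<lambda>_. p)) (\<lambda>\<omega>. (\<Sum>k\<in>A. g (\<omega> k))\<^sup>2)
      = real (card A) * measure_pmf.expectation p (\<lambda>y. (g y)\<^sup>2)"
proof -
  note [simp] = integrable_measure_pmf_finite finite_set_Pi_pmf assms(2)
  have "measure_pmf.expectation (Pi_pmf A dflt (\<lambda>_. p)) (\<lambda>\<omega>. \<Sum>k\<in>A. g (\<omega> k)) = 0
    \<and> measure_pmf.expectation (Pi_pmf A dflt (\<lambda>_. p)) (\<lambda>\<omega>. (\<Sum>k\<in>A. g (\<omega> k))\<^sup>2)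
      = real (card A) * measure_pmf.expectation p (\<lambda>y. (g y)\<^sup>2)"
    using assms(1)
  proof (induction A)
    case empty
    then show ?case by simp
  next
    case (insert k A)
    define S where "S \<omega> = (\<Sum>m\<in>A. g (\<omega> m))" for \<omega> :: "'a \<Rightarrow> 'b"
    have S: "(\<Sum>m\<in>insert k A. g (fun_upd \<omega> k y m)) = g y + S \<omega>" for y \<omega>
      unfolding S_def using insert.hyps by (simp, intro sum.cong) auto
    have "measure_pmf.expectation (Pi_pmf A dflt (\<lambda>_. p)) S = 0"
      "measure_pmf.expectation (Pi_pmf A dflt (\<lambda>_. p)) (\<lambda>\<omega>. (S \<omega>)\<^sup>2)
        = real (card A) * measure_pmf.expectation p (\<lambda>y. (g y)\<^sup>2)"
      unfolding S_def[abs_def] using insert.IH by blast+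
    then show ?case
      using insert.hyps g
      by (simp only: expectation_Pi_pmf_insert[OF insert.hyps assms(2)] S)
        (simp add: power2_sum algebra_simps)
  qed
  then show "measure_pmf.expectation (Pi_pmf A dflt (\<lambda>_. p)) (\<lambda>\<omega>. \<Sum>k\<in>A. g (\<omega> k)) = 0"
    and "measure_pmf.expectation (Pi_pmf A dflt (\<lambda>_. p)) (\<lambda>\<omega>. (\<Sum>k\<in>A. g (\<omega> k))\<^sup>2)
      = real (card A) * measure_pmf.expectation p (\<lambda>y. (g y)\<^sup>2)"
    by auto
qed

text \<open>The variance of a mean of \<open>M\<close> independent copies is the variance of one
  copy divided by \<open>M\<close>, and a variance is at most the second moment.\<close>

lemma expectation_sample_mean_deviation:
  fixes g :: "'b \<Rightarrow> real"
  assumes "finite (set_pmf p)" "1 \<le> M"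
  shows "measure_pmf.expectation (Pi_pmf {1..M} dflt (\<lambda>_. p))
      (\<lambda>\<omega>. ((\<Sum>k = 1..M. g (\<omega> k)) / real M - measure_pmf.expectation p g)\<^sup>2)
    \<le> measure_pmf.expectation p (\<lambda>y. (g y)\<^sup>2) / real M"
proof -
  note [simp] = integrable_measure_pmf_finite finite_set_Pi_pmf assms(1)
  let ?e = "measure_pmf.expectation p g"
  have *: "((\<Sum>k = 1..M. g (\<omega> k)) / real M - ?e)\<^sup>2 = (\<Sum>k = 1..M. g (\<omega> k) - ?e)\<^sup>2 / (real M)\<^sup>2" for \<omega>
    using assms(2) by (simp add: sum_subtractf field_simps flip: power_divide)
  have "measure_pmf.expectation p (\<lambda>y. (g y - ?e)\<^sup>2) = measure_pmf.expectation p (\<lambda>y. (g y)\<^sup>2) - ?e\<^sup>2"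
    by (simp add: power2_diff) (simp add: power2_eq_square)
  then have "measure_pmf.expectation (Pi_pmf {1..M} dflt (\<lambda>_. p)) (\<lambda>\<omega>. (\<Sum>k = 1..M. g (\<omega> k) - ?e)\<^sup>2)
      \<le> real M * measure_pmf.expectation p (\<lambda>y. (g y)\<^sup>2)"
    using expectation_sum_Pi_pmf(2)[of "{1..M}" p "\<lambda>y. g y - ?e" dflt]
    by (simp add: mult_left_mono)
  then show ?thesis
    using assms(2) unfolding * by (simp add: field_simps power2_eq_square)
qed

section \<open>Minkowski and Cauchy-Schwarz inequalities\<close>

lemma L2_set_sum_le:
  "L2_set (\<lambda>a. \<Sum>j\<in>J. f j a) A \<le> (\<Sum>j\<in>J. L2_set (f j) A)"
proof (induction J rule: infinite_finite_induct)
  case (insert j J)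
  then show ?case
    using L2_set_triangle_ineq[of "f j" "\<lambda>a. \<Sum>j\<in>J. f j a" A] by simp
qed (simp_all add: L2_set_0')

text \<open>The Cauchy-Schwarz inequality for \<open>sqrt (c i)\<close> and
  \<open>sqrt (c i) * y i\<close>. For weights of sum at most 1 it serves as Jensen's
  inequality.\<close>

lemma weighted_sum_power2_le:
  fixes c y :: "'a \<Rightarrow> real"
  assumes "\<And>i. i \<in> I \<Longrightarrow> 0 \<le> c i"
  shows "(\<Sum>i\<in>I. c i * y i)\<^sup>2 \<le> (\<Sum>i\<in>I. c i) * (\<Sum>i\<in>I. c i * (y i)\<^sup>2)"
proof -
  have "(\<Sum>i\<in>I. sqrt (c i) * (sqrt (c i) * y i))\<^sup>2
      \<le> (\<Sum>i\<in>I. (sqrt (c i))\<^sup>2) * (\<Sum>i\<in>I. (sqrt (c i) * y i)\<^sup>2)"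
    by (rule Cauchy_Schwarz_ineq_sum)
  moreover have "(\<Sum>i\<in>I. sqrt (c i) * (sqrt (c i) * y i)) = (\<Sum>i\<in>I. c i * y i)"
    "(\<Sum>i\<in>I. (sqrt (c i))\<^sup>2) = (\<Sum>i\<in>I. c i)"
    "(\<Sum>i\<in>I. (sqrt (c i) * y i)\<^sup>2) = (\<Sum>i\<in>I. c i * (y i)\<^sup>2)"
    using assms by (auto intro!: sum.cong simp: power_mult_distrib simp flip: mult.assoc)
  ultimately show ?thesis by simp
qed

text \<open>The root of the expected mean square is an L2 norm on pairs of a sample and a data
  point, so Minkowski's inequality adds up the bounds \<open>c a\<close> and
  \<open>e\<close>.\<close>

lemma mean_square_le:
  fixes R :: "'w pmf" and X G :: "'w \<Rightarrow> nat \<Rightarrow> real" and F :: "'a \<Rightarrow> 'w \<Rightarrow> nat \<Rightarrow> real"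
  assumes fin: "finite (set_pmf R)"
    and X: "\<And>\<omega> m. \<omega> \<in> set_pmf R \<Longrightarrow> m \<in> {1..n} \<Longrightarrow> \<bar>X \<omega> m\<bar> \<le> (\<Sum>a\<in>J. \<bar>F a \<omega> m\<bar>) + \<bar>G \<omega> m\<bar>"
    and F: "\<And>a. a \<in> J \<Longrightarrow> measure_pmf.expectation R (\<lambda>\<omega>. (1 / real n) * (\<Sum>m = 1..n. (F a \<omega> m)\<^sup>2)) \<le> (c a)\<^sup>2"
    and c: "\<And>a. a \<in> J \<Longrightarrow> 0 \<le> c a"
    and G: "measure_pmf.expectation R (\<lambda>\<omega>. (1 / real n) * (\<Sum>m = 1..n. (G \<omega> m)\<^sup>2)) \<le> e\<^sup>2"
    and e: "0 \<le> e"
  shows "measure_pmf.expectation R (\<lambda>\<omega>. (1 / real n) * (\<Sum>m = 1..n. (X \<omega> m)\<^sup>2)) \<le> ((\<Sum>a\<in>J. c a) + e)\<^sup>2"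
proof -
  define \<Omega> where "\<Omega> = set_pmf R \<times> {1..n}"
  \<comment> \<open>The square root of the mass of a pair under the product of \<open>R\<close> and
    the uniform law on the dataset; it turns the expectation into
    \<open>(N Y)\<^sup>2\<close>.\<close>
  define w where "w a = sqrt (pmf R (fst a) / real n)" for a :: "'w \<times> nat"
  define N where "N Y = L2_set (\<lambda>a. w a * Y (fst a) (snd a)) \<Omega>" for Y :: "'w \<Rightarrow> nat \<Rightarrow> real"
  have N: "measure_pmf.expectation R (\<lambda>\<omega>. (1 / real n) * (\<Sum>m = 1..n. (Y \<omega> m)\<^sup>2)) = (N Y)\<^sup>2" for Y
  proof -
    have "measure_pmf.expectation R (\<lambda>\<omega>. (1 / real n) * (\<Sum>m = 1..n. (Y \<omega> m)\<^sup>2))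
        = (\<Sum>\<omega>\<in>set_pmf R. (1 / real n) * (\<Sum>m = 1..n. (Y \<omega> m)\<^sup>2) * pmf R \<omega>)"
      by (rule integral_measure_pmf_real[OF fin])
    also have "\<dots> = (\<Sum>\<omega>\<in>set_pmf R. \<Sum>m = 1..n. (w (\<omega>, m) * Y \<omega> m)\<^sup>2)"
      by (simp add: w_def power_mult_distrib sum_distrib_left sum_distrib_right sum_divide_distrib mult_ac)
    also have "\<dots> = (\<Sum>a\<in>\<Omega>. (w a * Y (fst a) (snd a))\<^sup>2)"
      by (simp add: \<Omega>_def sum.cartesian_product case_prod_unfold)
    finally show ?thesis by (simp add: N_def L2_set_def sum_nonneg)
  qed
  have w: "0 \<le> w a" for a by (simp add: w_def)
  have N_abs: "N (\<lambda>\<omega> m. \<bar>Y \<omega> m\<bar>) = N Y" for Y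
    by (simp add: N_def L2_set_def power_mult_distrib)
  have "N X = N (\<lambda>\<omega> m. \<bar>X \<omega> m\<bar>)" by (simp add: N_abs)
  also have "\<dots> \<le> N (\<lambda>\<omega> m. (\<Sum>a\<in>J. \<bar>F a \<omega> m\<bar>) + \<bar>G \<omega> m\<bar>)"
    unfolding N_def by (rule L2_set_mono) (auto simp: \<Omega>_def w intro!: mult_left_mono X)
  also have "\<dots> \<le> N (\<lambda>\<omega> m. \<Sum>a\<in>J. \<bar>F a \<omega> m\<bar>) + N (\<lambda>\<omega> m. \<bar>G \<omega> m\<bar>)"
    unfolding N_def distrib_left by (rule L2_set_triangle_ineq)
  also have "\<dots> \<le> (\<Sum>a\<in>J. N (\<lambda>\<omega> m. \<bar>F a \<omega> m\<bar>)) + N (\<lambda>\<omega> m. \<bar>G \<omega> m\<bar>)"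
    unfolding N_def sum_distrib_left by (intro add_mono L2_set_sum_le order_refl)
  also have "\<dots> \<le> (\<Sum>a\<in>J. c a) + e"
    unfolding N_abs using F[unfolded N] c G[unfolded N] e
    by (intro add_mono sum_mono) (auto intro: power2_le_imp_le)
  finally have "N X \<le> (\<Sum>a\<in>J. c a) + e" .
  moreover have "0 \<le> N X" by (simp add: N_def)
  ultimately show ?thesis unfolding N by (rule power_mono)
qed

lemma expectation_mean:
  fixes Y :: "nat \<Rightarrow> 'w \<Rightarrow> real"
  assumes "finite (set_pmf R)"
  shows "measure_pmf.expectation R (\<lambda>\<omega>. (1 / real n) * (\<Sum>m = 1..n. Y m \<omega>))
    = (1 / real n) * (\<Sum>m = 1..n. measure_pmf.expectation R (Y m))"
  using assms by (simp add: integrable_measure_pmf_finite)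

subsection \<open>Normalised inputs\<close>

text \<open>Ensures that normalising the inputs loses nothing although division by 0 gives 0. The
  weight is a maximum or a power mean of absolute values, which vanishes only if all of them
  do.\<close>

lemma input_weight_eq_0:
  assumes "1 \<le> q" "m \<in> {1..n}" "input_weight q n x j = 0"
  shows "x m j = 0"
proof (cases "q = 1")
  case True
  have "\<bar>x m j\<bar> \<le> Max ((\<lambda>m. \<bar>x m j\<bar>) ` {1..n})" using assms(2) by (intro Max_ge) auto
  with True assms(3) show ?thesis by (simp add: input_weight_def)
next
  case False
  then have "(\<Sum>m = 1..n. \<bar>x m j\<bar> powr (q / (q - 1))) = 0"
    using assms by (auto simp: input_weight_def Let_def)
  then have "\<bar>x m j\<bar> powr (q / (q - 1)) = 0"
    using assms(2) by (subst (asm) sum_nonneg_eq_0_iff) auto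
  then show ?thesis by simp
qed

text \<open>For \<open>q \<le> 2\<close> the conjugate exponent \<open>q'\<close> is at least \<open>2\<close>, so this is the monotonicity of
  power means; it follows by averaging Young's inequality \<open>y\<^sup>2 \<le> 2/q' * y powr q' + (1 - 2/q')\<close>.\<close>

lemma mean_square_normalized_input_le_1:
  assumes n: "1 \<le> n" and q: "1 \<le> q" "q \<le> 2"
  shows "(1 / real n) * (\<Sum>m = 1..n. (x m j / input_weight q n x j)\<^sup>2) \<le> 1"
proof (cases "input_weight q n x j = 0")
  case True
  then show ?thesis by simp
next
  case False
  let ?u = "input_weight q n x j"
  have u: "0 < ?u" using False input_weight_nonneg[OF n, of q x j] by linarith
  have "(\<Sum>m = 1..n. (x m j / ?u)\<^sup>2) \<le> real n"
  proof (cases "q = 1")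
    case True
    have "(x m j / ?u)\<^sup>2 \<le> 1" if "m \<in> {1..n}" for m
    proof -
      have "\<bar>x m j\<bar> \<le> ?u" unfolding input_weight_def using that True by (auto intro!: Max_ge)
      then have "\<bar>x m j / ?u\<bar> \<le> 1" using u by simp
      then show ?thesis by (simp only: abs_square_le_1)
    qed
    then have "(\<Sum>m = 1..n. (x m j / ?u)\<^sup>2) \<le> (\<Sum>m = 1..n. 1)" by (rule sum_mono)
    then show ?thesis by simp
  next
    case False
    with q have q1: "1 < q" by simp
    define q' where "q' = q / (q - 1)"
    \<comment> \<open>This is where \<open>q \<le> 2\<close> enters: \<open>q / (q - 1)\<close>
      decreases in \<open>q\<close> and equals 2 at \<open>q = 2\<close>.\<close>
    have q': "2 \<le> q'" using q q1 by (simp add: q'_def field_simps)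
    define y where "y m = \<bar>x m j\<bar> / ?u" for m
    have young: "(y m)\<^sup>2 \<le> 2 / q' * y m powr q' + (1 - 2 / q')" for m
    proof (cases "x m j = 0")
      case True
      then show ?thesis using q' by (simp add: y_def)
    next
      case False
      then have y: "0 < y m" using u by (simp add: y_def)
      then show ?thesis
        using Youngs_inequality_0[of "2 / q'" "1 - 2 / q'" "y m powr q'" 1] q'
        by (simp add: powr_powr)
    qed
    have S: "?u = ((1 / real n) * (\<Sum>m = 1..n. \<bar>x m j\<bar> powr q')) powr (1 / q')"
      using False by (simp add: input_weight_def q'_def Let_def)
    have "?u powr q' = (1 / real n) * (\<Sum>m = 1..n. \<bar>x m j\<bar> powr q')"
      unfolding S using q' by (simp add: powr_powr sum_nonneg)
    then have "(\<Sum>m = 1..n. \<bar>x m j\<bar> powr q') = real n * ?u powr q'"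
      using n by simp
    \<comment> \<open>By the choice of \<open>?u\<close>, the mean of the normalised
      \<open>q'\<close>-th powers is exactly 1.\<close>
    then have "(\<Sum>m = 1..n. y m powr q') = real n"
      using u by (simp add: y_def powr_divide flip: sum_divide_distrib)
    moreover have "(\<Sum>m = 1..n. (y m)\<^sup>2) \<le> 2 / q' * (\<Sum>m = 1..n. y m powr q') + real n * (1 - 2 / q')"
      using sum_mono[of "{1..n}", OF young] by (simp add: sum.distrib sum_distrib_left)
    ultimately have "(\<Sum>m = 1..n. (y m)\<^sup>2) \<le> real n"
      using q' by (simp add: field_simps)
    then show ?thesis by (simp add: y_def power_divide)
  qed
  then show ?thesis using n by simp
qed

subsection \<open>Marginals of path distributions\<close>

lemma measure_pmf_eq_sum_paths:
  assumes "set_pmf P \<subseteq> paths L d"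
  shows "measure_pmf.prob P {\<pi>. A \<pi>} = (\<Sum>\<pi> | \<pi> \<in> paths L d \<and> A \<pi>. pmf P \<pi>)"
proof -
  have "measure_pmf.prob P {\<pi>. A \<pi>} = measure_pmf.prob P ({\<pi>. A \<pi>} \<inter> set_pmf P)"
    by (rule measure_Int_set_pmf[symmetric])
  also have "{\<pi>. A \<pi>} \<inter> set_pmf P = {\<pi> \<in> paths L d. A \<pi>} \<inter> set_pmf P"
    using assms by auto
  also have "measure_pmf.prob P \<dots> = measure_pmf.prob P {\<pi> \<in> paths L d. A \<pi>}"
    by (rule measure_Int_set_pmf)
  also have "\<dots> = (\<Sum>\<pi> | \<pi> \<in> paths L d \<and> A \<pi>. pmf P \<pi>)"
    by (rule measure_measure_pmf_finite) simp
  finally show ?thesis .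
qed

text \<open>Sorts the paths by their unit in layer \<open>l - 1\<close>. The path variables averaged
  later all have this form: they live on one unit of layer \<open>l\<close> and depend on the unit
  just below.\<close>

lemma expectation_pair_marginal:
  fixes f :: "nat \<Rightarrow> real"
  assumes P: "set_pmf P \<subseteq> paths L d" and l: "1 \<le> l" "l \<le> L"
  shows "measure_pmf.expectation P (\<lambda>\<pi>. of_bool (\<pi> l = j) * f (\<pi> (l - 1)))
    = (\<Sum>i = 1..d (l - 1). pair_marginal L d (pmf P) l j i * f i)"
proof -
  have "measure_pmf.expectation P (\<lambda>\<pi>. of_bool (\<pi> l = j) * f (\<pi> (l - 1)))
      = (\<Sum>\<pi>\<in>paths L d. (of_bool (\<pi> l = j) * f (\<pi> (l - 1))) * pmf P \<pi>)"
    by (rule integral_measure_pmf_real) (use P in auto)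
  also have "\<dots> = (\<Sum>i = 1..d (l - 1). \<Sum>\<pi> | \<pi> \<in> paths L d \<and> \<pi> (l - 1) = i.
      (of_bool (\<pi> l = j) * f (\<pi> (l - 1))) * pmf P \<pi>)"
    by (rule sum.group[symmetric]) (use l paths_range[of _ L d "l - 1"] in auto)
  also have "\<dots> = (\<Sum>i = 1..d (l - 1). pair_marginal L d (pmf P) l j i * f i)"
  proof (rule sum.cong[OF refl])
    fix i
    show "(\<Sum>\<pi> | \<pi> \<in> paths L d \<and> \<pi> (l - 1) = i. (of_bool (\<pi> l = j) * f (\<pi> (l - 1))) * pmf P \<pi>)
        = pair_marginal L d (pmf P) l j i * f i"
      unfolding pair_marginal_def sum_distrib_right
      by (rule sum.mono_neutral_cong_right) auto
  qed
  finally show ?thesis .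
qed

text \<open>Consistency of the marginals: every path has exactly one unit in layer \<open>l\<close>.
  Through it the errors of one layer enter the next with their own weights and are not
  amplified.\<close>

lemma sum_pair_marginal:
  assumes "1 \<le> l" "l \<le> L"
  shows "(\<Sum>j = 1..d l. pair_marginal L d r l j i) = marginal L d r (l - 1) i"
proof -
  have "(\<Sum>j = 1..d l. pair_marginal L d r l j i)
      = (\<Sum>j = 1..d l. sum r {\<pi> \<in> {\<pi> \<in> paths L d. \<pi> (l - 1) = i}. \<pi> l = j})"
    unfolding pair_marginal_def by (intro sum.cong) (auto intro!: arg_cong[of _ _ "sum r"])
  also have "\<dots> = marginal L d r (l - 1) i"
    unfolding marginal_def
    by (rule sum.group) (use assms paths_range[of _ L d l] in auto)
  finally show ?thesis .
qed

lemma sum_marginal: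
  assumes "set_pmf P \<subseteq> paths L d" "l \<le> L"
  shows "(\<Sum>j = 1..d l. marginal L d (pmf P) l j) = 1"
proof -
  have "(\<Sum>j = 1..d l. marginal L d (pmf P) l j) = sum (pmf P) (paths L d)"
    unfolding marginal_def
    by (rule sum.group) (use assms paths_range[of _ L d l] in auto)
  also have "\<dots> = 1" using assms by (intro sum_pmf_eq_1) auto
  finally show ?thesis .
qed

lemma marginal_pmf_nonneg: "0 \<le> marginal L d (pmf P) l j"
  and pair_marginal_pmf_nonneg: "0 \<le> pair_marginal L d (pmf P) l j i"
  by (simp_all add: marginal_def pair_marginal_def sum_nonneg)

text \<open>Holds also where the marginal is 0, since the pair marginal is squeezed between 0 and
  the marginal.\<close>

lemma marginal_mult_conditional:
  assumes "1 \<le> l" "l \<le> L" "i \<in> {1..d (l - 1)}"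
  shows "marginal L d (pmf P) l j * conditional L d (pmf P) l j i = pair_marginal L d (pmf P) l j i"
proof -
  have "pair_marginal L d (pmf P) l j i \<le> marginal L d (pmf P) l j"
    unfolding marginal_eq_sum_pair_marginal[OF assms(1,2)]
    using assms(3) by (intro member_le_sum pair_marginal_pmf_nonneg) auto
  with pair_marginal_pmf_nonneg[of L d P l j i] show ?thesis
    by (auto simp: conditional_def)
qed

text \<open>Only an inequality, because the conditional law given a unit of probability 0 is
  identically 0.\<close>

lemma sum_conditional_le_1:
  assumes "1 \<le> l" "l \<le> L"
  shows "(\<Sum>i = 1..d (l - 1). conditional L d (pmf P) l j i) \<le> 1"
  by (simp add: conditional_def marginal_eq_sum_pair_marginal[OF assms] flip: sum_divide_distrib)

lemma conditional_pmf_nonneg: "0 \<le> conditional L d (pmf P) l j i"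
  by (simp add: conditional_def marginal_pmf_nonneg pair_marginal_pmf_nonneg)

subsection \<open>Propagation of errors through the layers\<close>

lemma relu_abs_diff_le: "\<bar>relu a - relu b\<bar> \<le> \<bar>a - b\<bar>"
  by (simp add: relu_def)

lemma relu_power2_le: "(relu a)\<^sup>2 \<le> a\<^sup>2"
  by (simp add: relu_def max_def)

abbreviation path_hidden ::
  "nat \<Rightarrow> (nat \<Rightarrow> nat) \<Rightarrow> (nat \<Rightarrow> nat \<Rightarrow> real) \<Rightarrow> (nat \<Rightarrow> nat) pmf \<Rightarrow> (nat \<Rightarrow> real) \<Rightarrow> nat \<Rightarrow> nat \<Rightarrow> real"
  where "path_hidden L d s P v \<equiv> hidden d s (dist_weights L d (pmf P)) v"

abbreviation path_network ::
  "nat \<Rightarrow> (nat \<Rightarrow> nat) \<Rightarrow> (nat \<Rightarrow> nat \<Rightarrow> real) \<Rightarrow> (nat \<Rightarrow> nat) pmf \<Rightarrow> (nat \<Rightarrow> real) \<Rightarrow> nat \<Rightarrow> real"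
  where "path_network L d s P v \<equiv> network L d s (dist_weights L d (pmf P)) v"

text \<open>The conditional mean, given unit \<open>j\<close>, of the hidden values one layer below.
  The conditional law is taken for \<open>l = L\<close> as well, where the network itself uses the
  pair marginal.\<close>

definition preactivation ::
  "nat \<Rightarrow> (nat \<Rightarrow> nat) \<Rightarrow> (nat \<Rightarrow> nat \<Rightarrow> real) \<Rightarrow> (nat \<Rightarrow> nat) pmf \<Rightarrow> (nat \<Rightarrow> real) \<Rightarrow> nat \<Rightarrow> nat \<Rightarrow> real"
  where "preactivation L d s P v l j
    = (\<Sum>i = 1..d (l - 1). conditional L d (pmf P) l j i * path_hidden L d s P v (l - 1) i)"

text \<open>The centred variable of a single path. Its mean under \<open>P\<close> is 0, and its
  mean under the empirical law is the deviation \<open>D l j\<close>.\<close>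

definition hidden_dev ::
  "nat \<Rightarrow> (nat \<Rightarrow> nat) \<Rightarrow> (nat \<Rightarrow> nat \<Rightarrow> real) \<Rightarrow> (nat \<Rightarrow> nat) pmf \<Rightarrow> (nat \<Rightarrow> real) \<Rightarrow> nat \<Rightarrow> nat
    \<Rightarrow> (nat \<Rightarrow> nat) \<Rightarrow> real"
  where "hidden_dev L d s P v l j \<pi>
    = of_bool (\<pi> l = j) * (path_hidden L d s P v (l - 1) (\<pi> (l - 1)) - preactivation L d s P v l j)"

definition output_term ::
  "nat \<Rightarrow> (nat \<Rightarrow> nat) \<Rightarrow> (nat \<Rightarrow> nat \<Rightarrow> real) \<Rightarrow> (nat \<Rightarrow> nat) pmf \<Rightarrow> (nat \<Rightarrow> real) \<Rightarrow> nat
    \<Rightarrow> (nat \<Rightarrow> nat) \<Rightarrow> real"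
  where "output_term L d s P v j \<pi> = of_bool (\<pi> L = j) * path_hidden L d s P v (L - 1) (\<pi> (L - 1))"

lemma path_hidden_Suc:
  "Suc l < L \<Longrightarrow> path_hidden L d s P v (Suc l) j = s (Suc l) j * relu (preactivation L d s P v (Suc l) j)"
  by (simp add: dist_weights_def preactivation_def)

lemma sum_pair_marginal_path_hidden:
  assumes "1 \<le> l" "l \<le> L"
  shows "(\<Sum>i = 1..d (l - 1). pair_marginal L d (pmf P) l j i * path_hidden L d s P v (l - 1) i)
    = marginal L d (pmf P) l j * preactivation L d s P v l j"
  unfolding preactivation_def sum_distrib_left
  by (rule sum.cong) (use assms in \<open>simp_all flip: marginal_mult_conditional mult.assoc\<close>)

lemma path_network_eq_expectation:
  assumes "set_pmf P \<subseteq> paths L d" "1 \<le> L"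
  shows "path_network L d s P v j = measure_pmf.expectation P (output_term L d s P v j)"
  using expectation_pair_marginal[OF assms order_refl, of j "path_hidden L d s P v (L - 1)"]
  unfolding output_term_def[abs_def] network_def by (simp add: dist_weights_def)

lemma expectation_hidden_dev:
  assumes "set_pmf Q \<subseteq> paths L d" "1 \<le> l" "l \<le> L"
  shows "measure_pmf.expectation Q (hidden_dev L d s P v l j)
    = (\<Sum>i = 1..d (l - 1). pair_marginal L d (pmf Q) l j i * path_hidden L d s P v (l - 1) i)
      - marginal L d (pmf Q) l j * preactivation L d s P v l j"
  unfolding hidden_dev_def[abs_def] expectation_pair_marginal[OF assms, of j
      "\<lambda>i. path_hidden L d s P v (l - 1) i - preactivation L d s P v l j"]
  using assms
  by (simp add: marginal_eq_sum_pair_marginal right_diff_distrib sum_subtractf sum_distrib_right)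

text \<open>As the activation is 1-Lipschitz, preactivations can be compared. Their weighted
  difference splits into the errors below, averaged over the pair law of \<open>Q\<close>, and the
  mean of \<open>hidden_dev\<close>.\<close>

lemma hidden_error_step:
  assumes Q: "set_pmf Q \<subseteq> paths L d" and l: "Suc l < L"
    and s: "\<And>j. j \<in> {1..d (Suc l)} \<Longrightarrow> \<bar>s (Suc l) j\<bar> = 1"
  shows "(\<Sum>j = 1..d (Suc l). marginal L d (pmf Q) (Suc l) j *
        \<bar>path_hidden L d s Q v (Suc l) j - path_hidden L d s P v (Suc l) j\<bar>)
    \<le> (\<Sum>i = 1..d l. marginal L d (pmf Q) l i * \<bar>path_hidden L d s Q v l i - path_hidden L d s P v l i\<bar>)
      + (\<Sum>j = 1..d (Suc l). \<bar>measure_pmf.expectation Q (hidden_dev L d s P v (Suc l) j)\<bar>)"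
proof -
  let ?q = "pair_marginal L d (pmf Q) (Suc l)" and ?m = "marginal L d (pmf Q)"
  let ?e = "\<lambda>l i. \<bar>path_hidden L d s Q v l i - path_hidden L d s P v l i\<bar>"
  let ?D = "\<lambda>j. measure_pmf.expectation Q (hidden_dev L d s P v (Suc l) j)"
  have "?m (Suc l) j * ?e (Suc l) j \<le> (\<Sum>i = 1..d l. ?q j i * ?e l i) + \<bar>?D j\<bar>"
    if j: "j \<in> {1..d (Suc l)}" for j
  proof -
    have "?e (Suc l) j = \<bar>s (Suc l) j\<bar> * \<bar>relu (preactivation L d s Q v (Suc l) j) - relu (preactivation L d s P v (Suc l) j)\<bar>"
      using l by (simp add: path_hidden_Suc abs_mult del: hidden.simps flip: right_diff_distrib)
    also have "\<dots> \<le> \<bar>preactivation L d s Q v (Suc l) j - preactivation L d s P v (Suc l) j\<bar>"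
      using relu_abs_diff_le s[OF j] by simp
    finally have "?m (Suc l) j * ?e (Suc l) j
        \<le> ?m (Suc l) j * \<bar>preactivation L d s Q v (Suc l) j - preactivation L d s P v (Suc l) j\<bar>"
      by (intro mult_left_mono marginal_pmf_nonneg)
    also have "\<dots> = \<bar>?m (Suc l) j * preactivation L d s Q v (Suc l) j - ?m (Suc l) j * preactivation L d s P v (Suc l) j\<bar>"
      using marginal_pmf_nonneg[of L d Q "Suc l" j] by (simp add: abs_mult flip: right_diff_distrib)
    also have "?m (Suc l) j * preactivation L d s Q v (Suc l) j = (\<Sum>i = 1..d l. ?q j i * path_hidden L d s Q v l i)"
      using sum_pair_marginal_path_hidden[of "Suc l" L d Q j s v] l by simp
    \<comment> \<open>The preactivation belongs to \<open>P\<close> but its weight to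
      \<open>Q\<close>; the discrepancy is exactly the mean of the centred variable under
      \<open>Q\<close>.\<close>
    also have "?m (Suc l) j * preactivation L d s P v (Suc l) j = (\<Sum>i = 1..d l. ?q j i * path_hidden L d s P v l i) - ?D j"
      using expectation_hidden_dev[OF Q, of "Suc l" s P v j] l by simp
    also have "\<bar>(\<Sum>i = 1..d l. ?q j i * path_hidden L d s Q v l i)
          - ((\<Sum>i = 1..d l. ?q j i * path_hidden L d s P v l i) - ?D j)\<bar>
        = \<bar>(\<Sum>i = 1..d l. ?q j i * (path_hidden L d s Q v l i - path_hidden L d s P v l i)) + ?D j\<bar>"
      by (simp add: right_diff_distrib sum_subtractf)
    also have "\<dots> \<le> (\<Sum>i = 1..d l. \<bar>?q j i * (path_hidden L d s Q v l i - path_hidden L d s P v l i)\<bar>) + \<bar>?D j\<bar>"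
      by (intro order_trans[OF abs_triangle_ineq] add_mono sum_abs order_refl)
    also have "\<dots> = (\<Sum>i = 1..d l. ?q j i * ?e l i) + \<bar>?D j\<bar>"
      by (simp add: abs_mult abs_of_nonneg[OF pair_marginal_pmf_nonneg])
    finally show ?thesis .
  qed
  then have "(\<Sum>j = 1..d (Suc l). ?m (Suc l) j * ?e (Suc l) j)
      \<le> (\<Sum>j = 1..d (Suc l). (\<Sum>i = 1..d l. ?q j i * ?e l i) + \<bar>?D j\<bar>)"
    by (rule sum_mono)
  also have "\<dots> = (\<Sum>i = 1..d l. (\<Sum>j = 1..d (Suc l). ?q j i) * ?e l i) + (\<Sum>j = 1..d (Suc l). \<bar>?D j\<bar>)"
    unfolding sum.distrib sum_distrib_right by (subst sum.swap) simp
  also have "\<dots> = (\<Sum>i = 1..d l. ?m l i * ?e l i) + (\<Sum>j = 1..d (Suc l). \<bar>?D j\<bar>)"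
    using l sum_pair_marginal[of "Suc l" L d "pmf Q"] by simp
  finally show ?thesis .
qed

text \<open>Iterates the one-layer bound. Both networks receive the same input, so the error at
  layer 0 is 0.\<close>

lemma hidden_error_le:
  assumes Q: "set_pmf Q \<subseteq> paths L d" and l: "l < L"
    and s: "\<And>l j. l \<in> {1..<L} \<Longrightarrow> j \<in> {1..d l} \<Longrightarrow> \<bar>s l j\<bar> = 1"
  shows "(\<Sum>j = 1..d l. marginal L d (pmf Q) l j *
        \<bar>path_hidden L d s Q v l j - path_hidden L d s P v l j\<bar>)
    \<le> (\<Sum>l' = 1..l. \<Sum>j = 1..d l'. \<bar>measure_pmf.expectation Q (hidden_dev L d s P v l' j)\<bar>)"
  using l
proof (induction l)
  case 0
  then show ?case by simp
next
  case (Suc l)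
  then show ?case
    using hidden_error_step[OF Q, of l s v P] s[of "Suc l"] by (simp del: hidden.simps)
qed

text \<open>The part inherited from the hidden layers is bounded by a sum of absolute values, to
  which consistency of the marginals applies. The deviation of the output terms stays an L2 norm, so
  that its mean square can be bounded independently of the number of outputs.\<close>

lemma L2_set_path_network_diff_le:
  assumes L: "1 \<le> L" and P: "set_pmf P \<subseteq> paths L d" and Q: "set_pmf Q \<subseteq> paths L d"
    and s: "\<And>l j. l \<in> {1..<L} \<Longrightarrow> j \<in> {1..d l} \<Longrightarrow> \<bar>s l j\<bar> = 1"
  shows "L2_set (\<lambda>j. path_network L d s Q v j - path_network L d s P v j) {1..d L}
    \<le> (\<Sum>l = 1..L - 1. \<Sum>j = 1..d l. \<bar>measure_pmf.expectation Q (hidden_dev L d s P v l j)\<bar>)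
      + L2_set (\<lambda>j. measure_pmf.expectation Q (output_term L d s P v j)
          - measure_pmf.expectation P (output_term L d s P v j)) {1..d L}"
proof -
  let ?q = "pair_marginal L d (pmf Q) L"
  let ?e = "\<lambda>i. path_hidden L d s Q v (L - 1) i - path_hidden L d s P v (L - 1) i"
  let ?C = "\<lambda>j. measure_pmf.expectation Q (output_term L d s P v j)
          - measure_pmf.expectation P (output_term L d s P v j)"
  have "path_network L d s Q v j - path_network L d s P v j = (\<Sum>i = 1..d (L - 1). ?q j i * ?e i) + ?C j" for j
    unfolding path_network_eq_expectation[OF P L] path_network_eq_expectation[OF Q L] output_term_def[abs_def]
      expectation_pair_marginal[OF Q L order_refl]
    by (simp add: right_diff_distrib sum_subtractf)
  then have "L2_set (\<lambda>j. path_network L d s Q v j - path_network L d s P v j) {1..d L}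
      \<le> L2_set (\<lambda>j. \<Sum>i = 1..d (L - 1). ?q j i * ?e i) {1..d L} + L2_set ?C {1..d L}"
    using L2_set_triangle_ineq[of "\<lambda>j. \<Sum>i = 1..d (L - 1). ?q j i * ?e i" ?C] by presburger
  also have "L2_set (\<lambda>j. \<Sum>i = 1..d (L - 1). ?q j i * ?e i) {1..d L}
      \<le> (\<Sum>j = 1..d L. \<bar>\<Sum>i = 1..d (L - 1). ?q j i * ?e i\<bar>)"
    by (rule L2_set_le_sum_abs)
  also have "\<dots> \<le> (\<Sum>j = 1..d L. \<Sum>i = 1..d (L - 1). \<bar>?q j i * ?e i\<bar>)"
    by (intro sum_mono sum_abs)
  also have "\<dots> = (\<Sum>i = 1..d (L - 1). (\<Sum>j = 1..d L. ?q j i) * \<bar>?e i\<bar>)"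
    unfolding sum_distrib_right
    by (subst sum.swap) (simp add: abs_mult abs_of_nonneg[OF pair_marginal_pmf_nonneg])
  also have "\<dots> = (\<Sum>i = 1..d (L - 1). marginal L d (pmf Q) (L - 1) i * \<bar>?e i\<bar>)"
    by (simp only: sum_pair_marginal[OF L order_refl])
  also have "\<dots> \<le> (\<Sum>l = 1..L - 1. \<Sum>j = 1..d l. \<bar>measure_pmf.expectation Q (hidden_dev L d s P v l j)\<bar>)"
    using L by (intro hidden_error_le[OF Q _ s]) auto
  finally show ?thesis by simp
qed

text \<open>Neither the sign nor the ReLU increases a square, and a preactivation averages the layer
  below with weights of sum at most 1. By Cauchy-Schwarz the bound passes up from the
  inputs.\<close>

lemma mean_square_path_hidden_le_1:
  assumes s: "\<And>l j. l \<in> {1..<L} \<Longrightarrow> j \<in> {1..d l} \<Longrightarrow> \<bar>s l j\<bar> = 1"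
    and z: "\<And>i. i \<in> {1..d 0} \<Longrightarrow> (1 / real n) * (\<Sum>m = 1..n. (z m i)\<^sup>2) \<le> 1"
    and "l < L" "j \<in> {1..d l}"
  shows "(1 / real n) * (\<Sum>m = 1..n. (path_hidden L d s P (z m) l j)\<^sup>2) \<le> 1"
  using assms(3,4)
proof (induction l arbitrary: j)
  case 0
  then show ?case using z by simp
next
  case (Suc l)
  let ?c = "conditional L d (pmf P) (Suc l) j"
  have c: "(\<Sum>i = 1..d l. ?c i) \<le> 1"
    using sum_conditional_le_1[of "Suc l" L d P j] Suc.prems by simp
  have "(path_hidden L d s P (z m) (Suc l) j)\<^sup>2 \<le> (\<Sum>i = 1..d l. ?c i * (path_hidden L d s P (z m) l i)\<^sup>2)" for m
  proof -
    have "(s (Suc l) j)\<^sup>2 = 1"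
      using s[of "Suc l" j] Suc.prems by (simp add: power2_eq_1_iff abs_if split: if_splits)
    then have "(path_hidden L d s P (z m) (Suc l) j)\<^sup>2 \<le> (preactivation L d s P (z m) (Suc l) j)\<^sup>2"
      using Suc.prems relu_power2_le by (simp add: path_hidden_Suc power_mult_distrib del: hidden.simps)
    also have "\<dots> \<le> (\<Sum>i = 1..d l. ?c i) * (\<Sum>i = 1..d l. ?c i * (path_hidden L d s P (z m) l i)\<^sup>2)"
      using weighted_sum_power2_le[OF conditional_pmf_nonneg] by (simp add: preactivation_def)
    also have "\<dots> \<le> 1 * (\<Sum>i = 1..d l. ?c i * (path_hidden L d s P (z m) l i)\<^sup>2)"
      by (intro mult_right_mono c sum_nonneg mult_nonneg_nonneg conditional_pmf_nonneg) auto
    finally show ?thesis by simp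
  qed
  then have "(1 / real n) * (\<Sum>m = 1..n. (path_hidden L d s P (z m) (Suc l) j)\<^sup>2)
      \<le> (1 / real n) * (\<Sum>m = 1..n. \<Sum>i = 1..d l. ?c i * (path_hidden L d s P (z m) l i)\<^sup>2)"
    by (intro mult_left_mono sum_mono) auto
  also have "\<dots> = (\<Sum>i = 1..d l. ?c i * ((1 / real n) * (\<Sum>m = 1..n. (path_hidden L d s P (z m) l i)\<^sup>2)))"
    by (subst sum.swap) (simp add: sum_distrib_left mult.left_commute)
  also have "\<dots> \<le> (\<Sum>i = 1..d l. ?c i * 1)"
    using Suc by (intro sum_mono mult_left_mono conditional_pmf_nonneg) auto
  finally show ?case using c by simp
qed

lemma mean_square_pair_marginal_le:
  assumes s: "\<And>l j. l \<in> {1..<L} \<Longrightarrow> j \<in> {1..d l} \<Longrightarrow> \<bar>s l j\<bar> = 1"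
    and z: "\<And>i. i \<in> {1..d 0} \<Longrightarrow> (1 / real n) * (\<Sum>m = 1..n. (z m i)\<^sup>2) \<le> 1"
    and l: "1 \<le> l" "l \<le> L"
  shows "(1 / real n) * (\<Sum>m = 1..n. \<Sum>i = 1..d (l - 1).
      pair_marginal L d (pmf P) l j i * (path_hidden L d s P (z m) (l - 1) i)\<^sup>2)
    \<le> marginal L d (pmf P) l j"
proof -
  let ?p = "pair_marginal L d (pmf P) l j"
  have "(1 / real n) * (\<Sum>m = 1..n. \<Sum>i = 1..d (l - 1). ?p i * (path_hidden L d s P (z m) (l - 1) i)\<^sup>2)
      = (\<Sum>i = 1..d (l - 1). ?p i * ((1 / real n) * (\<Sum>m = 1..n. (path_hidden L d s P (z m) (l - 1) i)\<^sup>2)))"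
    by (subst sum.swap) (simp add: sum_distrib_left mult.left_commute)
  also have "\<dots> \<le> (\<Sum>i = 1..d (l - 1). ?p i * 1)"
    using l by (intro sum_mono mult_left_mono pair_marginal_pmf_nonneg mean_square_path_hidden_le_1[OF s z]) auto
  finally show ?thesis using l by (simp add: marginal_eq_sum_pair_marginal)
qed

text \<open>The preactivation is the conditional mean, so centring at it lowers the second moment,
  by the marginal times the squared preactivation.\<close>

lemma expectation_hidden_dev_power2:
  assumes P: "set_pmf P \<subseteq> paths L d" and l: "1 \<le> l" "l \<le> L"
  shows "measure_pmf.expectation P (\<lambda>\<pi>. (hidden_dev L d s P v l j \<pi>)\<^sup>2)
    \<le> (\<Sum>i = 1..d (l - 1). pair_marginal L d (pmf P) l j i * (path_hidden L d s P v (l - 1) i)\<^sup>2)"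
proof -
  let ?p = "pair_marginal L d (pmf P) l j" and ?h = "path_hidden L d s P v (l - 1)"
    and ?a = "preactivation L d s P v l j" and ?m = "marginal L d (pmf P) l j"
  have "(\<lambda>\<pi>. (hidden_dev L d s P v l j \<pi>)\<^sup>2) = (\<lambda>\<pi>. of_bool (\<pi> l = j) * (?h (\<pi> (l - 1)) - ?a)\<^sup>2)"
    by (auto simp: hidden_dev_def)
  then have "measure_pmf.expectation P (\<lambda>\<pi>. (hidden_dev L d s P v l j \<pi>)\<^sup>2) = (\<Sum>i = 1..d (l - 1). ?p i * (?h i - ?a)\<^sup>2)"
    using expectation_pair_marginal[OF P l, of j "\<lambda>i. (?h i - ?a)\<^sup>2"] by simp
  also have "\<dots> = (\<Sum>i = 1..d (l - 1). ?p i * (?h i)\<^sup>2 - 2 * ?a * (?p i * ?h i) + ?a\<^sup>2 * ?p i)"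
    by (rule sum.cong) (simp_all add: power2_eq_square algebra_simps)
  also have "\<dots> = (\<Sum>i = 1..d (l - 1). ?p i * (?h i)\<^sup>2) - 2 * ?a * (\<Sum>i = 1..d (l - 1). ?p i * ?h i)
      + ?a\<^sup>2 * (\<Sum>i = 1..d (l - 1). ?p i)"
    by (simp only: sum.distrib sum_subtractf sum_distrib_left)
  also have "\<dots> = (\<Sum>i = 1..d (l - 1). ?p i * (?h i)\<^sup>2) - 2 * ?a * (?m * ?a) + ?a\<^sup>2 * ?m"
    by (simp only: sum_pair_marginal_path_hidden[OF l] marginal_eq_sum_pair_marginal[OF l])
  also have "\<dots> = (\<Sum>i = 1..d (l - 1). ?p i * (?h i)\<^sup>2) - ?m * ?a\<^sup>2"
    by (simp add: power2_eq_square)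
  also have "\<dots> \<le> (\<Sum>i = 1..d (l - 1). ?p i * (?h i)\<^sup>2)"
    using marginal_pmf_nonneg[of L d P l j] by simp
  finally show ?thesis .
qed

subsection \<open>Empirical path distributions\<close>

text \<open>The law of a uniformly chosen sampled path. It need not be Markov, but as a
  \<open>pmf\<close> on paths it falls under the error bounds for
  \<open>path_network\<close>.\<close>

definition emp_pmf :: "nat \<Rightarrow> (nat \<Rightarrow> nat \<Rightarrow> nat) \<Rightarrow> (nat \<Rightarrow> nat) pmf" where
  "emp_pmf M \<omega> = map_pmf \<omega> (pmf_of_set {1..M})"

lemma set_emp_pmf: "1 \<le> M \<Longrightarrow> set_pmf (emp_pmf M \<omega>) = \<omega> ` {1..M}"
  by (simp add: emp_pmf_def)

lemma expectation_emp_pmf: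
  fixes f :: "(nat \<Rightarrow> nat) \<Rightarrow> real"
  shows "1 \<le> M \<Longrightarrow> measure_pmf.expectation (emp_pmf M \<omega>) f = (\<Sum>k = 1..M. f (\<omega> k)) / real M"
  by (simp add: emp_pmf_def integral_pmf_of_set)

lemma marginal_emp_pmf:
  assumes "1 \<le> M" "\<And>k. k \<in> {1..M} \<Longrightarrow> \<omega> k \<in> paths L d"
  shows "marginal L d (pmf (emp_pmf M \<omega>)) l j = emp_marginal M \<omega> l j"
    and "pair_marginal L d (pmf (emp_pmf M \<omega>)) l j i = emp_pair M \<omega> l j i"
proof -
  have supp: "set_pmf (emp_pmf M \<omega>) \<subseteq> paths L d" using assms by (auto simp: set_emp_pmf)
  have "measure_pmf.prob (emp_pmf M \<omega>) {\<pi>. A \<pi>} = real (card {m \<in> {1..M}. A (\<omega> m)}) / real M" for A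
  proof -
    have "{1..M} \<inter> \<omega> -` {\<pi>. A \<pi>} = {m \<in> {1..M}. A (\<omega> m)}" by auto
    then show ?thesis using assms(1) by (simp add: emp_pmf_def measure_pmf_of_set)
  qed
  then show "marginal L d (pmf (emp_pmf M \<omega>)) l j = emp_marginal M \<omega> l j"
    and "pair_marginal L d (pmf (emp_pmf M \<omega>)) l j i = emp_pair M \<omega> l j i"
    unfolding marginal_def pair_marginal_def emp_marginal_def emp_pair_def
    by (simp_all flip: measure_pmf_eq_sum_paths[OF supp])
qed

text \<open>The mass of a path under \<open>emp_markov\<close> is its path weight for the weights of
  the empirical law, so renormalising by it reproduces the outputs for these weights. Hence the
  empirical law can stand in for its Markov version.\<close>

lemma dist_network_emp_markov:
  assumes L: "1 \<le> L" and M: "1 \<le> M" and \<omega>: "\<And>k. k \<in> {1..M} \<Longrightarrow> \<omega> k \<in> paths L d"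
    and j: "j \<in> {1..d L}"
  shows "dist_network L d s u (emp_markov L d M \<omega>) v j = path_network L d s (emp_pmf M \<omega>) (\<lambda>i. v i / u i) j"
proof -
  let ?W = "dist_weights L d (pmf (emp_pmf M \<omega>))"
  have emp: "marginal L d (pmf (emp_pmf M \<omega>)) l j = emp_marginal M \<omega> l j"
    "pair_marginal L d (pmf (emp_pmf M \<omega>)) l j i = emp_pair M \<omega> l j i" for l j i
    using marginal_emp_pmf[OF M] \<omega> by blast+
  have cond: "conditional L d (pmf (emp_pmf M \<omega>)) l j i = emp_conditional M \<omega> l j i" for l j i
    by (simp add: conditional_def emp_conditional_def emp)
  have "emp_markov L d M \<omega> \<pi> = path_weight L ?W \<pi>" if \<pi>: "\<pi> \<in> paths L d" for \<pi>
  proof -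
    obtain l where l: "L = Suc l" using L by (cases L) auto
    have "path_weight L ?W \<pi> = (\<Prod>l = 1..l. emp_conditional M \<omega> l (\<pi> l) (\<pi> (l - 1))) * emp_pair M \<omega> L (\<pi> L) (\<pi> (L - 1))"
      unfolding path_weight_def l prod.nat_ivl_Suc'[OF le_SucI[OF order_refl]]
      by (simp add: dist_weights_def cond[unfolded l] emp[unfolded l])
    \<comment> \<open>The top marginal and the top conditional merge into the pair marginal, the
      weight that \<open>dist_weights\<close> takes at layer \<open>L\<close>.\<close>
    also have "emp_pair M \<omega> L (\<pi> L) (\<pi> (L - 1))
        = emp_marginal M \<omega> L (\<pi> L) * emp_conditional M \<omega> L (\<pi> L) (\<pi> (L - 1))"
      using marginal_mult_conditional[of L L "\<pi> (L - 1)" d "emp_pmf M \<omega>" "\<pi> L"] L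
        paths_range[OF \<pi>, of "L - 1"] by (simp add: emp cond)
    finally show ?thesis using \<pi> by (simp add: emp_markov_def l)
  qed
  then have "1 * network L d s (dist_weights L d (emp_markov L d M \<omega>)) (\<lambda>i. (v i / u i) / 1) j
      = network L d s ?W (\<lambda>i. v i / u i) j"
    using L j
    by (intro network_dist_weights)
      (auto simp: dist_weights_def conditional_pmf_nonneg pair_marginal_pmf_nonneg)
  then show ?thesis by (simp add: dist_network_def)
qed

text \<open>The centred variable has mean 0 under \<open>P\<close>, so the mean square of its sample
  mean is at most its second moment over \<open>M\<close>. Averaged over the data, that moment is at
  most the marginal.\<close>

lemma mean_square_hidden_dev_le:
  assumes P: "set_pmf P \<subseteq> paths L d" and M: "1 \<le> M" and l: "1 \<le> l" "l \<le> L"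
    and s: "\<And>l j. l \<in> {1..<L} \<Longrightarrow> j \<in> {1..d l} \<Longrightarrow> \<bar>s l j\<bar> = 1"
    and z: "\<And>i. i \<in> {1..d 0} \<Longrightarrow> (1 / real n) * (\<Sum>m = 1..n. (z m i)\<^sup>2) \<le> 1"
  shows "measure_pmf.expectation (Pi_pmf {1..M} dflt (\<lambda>_. P)) (\<lambda>\<omega>. (1 / real n) * (\<Sum>m = 1..n.
      (measure_pmf.expectation (emp_pmf M \<omega>) (hidden_dev L d s P (z m) l j))\<^sup>2))
    \<le> marginal L d (pmf P) l j / real M"
proof -
  have finP: "finite (set_pmf P)" using P finite_paths by (rule finite_subset)
  let ?R = "Pi_pmf {1..M} dflt (\<lambda>_. P)"
  let ?Y = "\<lambda>m \<omega>. (measure_pmf.expectation (emp_pmf M \<omega>) (hidden_dev L d s P (z m) l j))\<^sup>2"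
  let ?S = "\<lambda>m. \<Sum>i = 1..d (l - 1). pair_marginal L d (pmf P) l j i * (path_hidden L d s P (z m) (l - 1) i)\<^sup>2"
  have finR: "finite (set_pmf ?R)" by (intro finite_set_Pi_pmf finP) simp
  have "measure_pmf.expectation ?R (?Y m) \<le> ?S m / real M" for m
  proof -
    have "measure_pmf.expectation P (hidden_dev L d s P (z m) l j) = 0"
      unfolding expectation_hidden_dev[OF P l] using sum_pair_marginal_path_hidden[OF l] by simp
    then have "measure_pmf.expectation ?R (?Y m)
        \<le> measure_pmf.expectation P (\<lambda>\<pi>. (hidden_dev L d s P (z m) l j \<pi>)\<^sup>2) / real M"
      using expectation_sample_mean_deviation[OF finP M, of dflt "hidden_dev L d s P (z m) l j"] M
      by (simp add: expectation_emp_pmf)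
    also have "\<dots> \<le> ?S m / real M"
      by (intro divide_right_mono expectation_hidden_dev_power2[OF P l]) simp
    finally show ?thesis .
  qed
  then have "measure_pmf.expectation ?R (\<lambda>\<omega>. (1 / real n) * (\<Sum>m = 1..n. ?Y m \<omega>))
      \<le> (1 / real n) * (\<Sum>m = 1..n. ?S m / real M)"
    unfolding expectation_mean[OF finR] by (intro mult_left_mono sum_mono) auto
  also have "\<dots> = ((1 / real n) * (\<Sum>m = 1..n. ?S m)) / real M"
    by (simp add: sum_divide_distrib mult.commute[of "real M" "real n"])
  also have "\<dots> \<le> marginal L d (pmf P) l j / real M"
    by (intro divide_right_mono mean_square_pair_marginal_le[OF s z l]) auto
  finally show ?thesis .
qed

text \<open>The variance bound is applied to each output separately. As the marginals of the output
  layer sum to 1, the number of outputs does not appear.\<close>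

lemma mean_square_output_dev_le:
  assumes P: "set_pmf P \<subseteq> paths L d" and M: "1 \<le> M" and L: "1 \<le> L"
    and s: "\<And>l j. l \<in> {1..<L} \<Longrightarrow> j \<in> {1..d l} \<Longrightarrow> \<bar>s l j\<bar> = 1"
    and z: "\<And>i. i \<in> {1..d 0} \<Longrightarrow> (1 / real n) * (\<Sum>m = 1..n. (z m i)\<^sup>2) \<le> 1"
  shows "measure_pmf.expectation (Pi_pmf {1..M} dflt (\<lambda>_. P)) (\<lambda>\<omega>. (1 / real n) * (\<Sum>m = 1..n.
      (L2_set (\<lambda>j. measure_pmf.expectation (emp_pmf M \<omega>) (output_term L d s P (z m) j)
          - measure_pmf.expectation P (output_term L d s P (z m) j)) {1..d L})\<^sup>2))
    \<le> 1 / real M"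
proof -
  have finP: "finite (set_pmf P)" using P finite_paths by (rule finite_subset)
  let ?R = "Pi_pmf {1..M} dflt (\<lambda>_. P)"
  let ?Y = "\<lambda>j m \<omega>. (measure_pmf.expectation (emp_pmf M \<omega>) (output_term L d s P (z m) j)
          - measure_pmf.expectation P (output_term L d s P (z m) j))\<^sup>2"
  let ?S = "\<lambda>j m. \<Sum>i = 1..d (L - 1). pair_marginal L d (pmf P) L j i * (path_hidden L d s P (z m) (L - 1) i)\<^sup>2"
  have finR: "finite (set_pmf ?R)" by (intro finite_set_Pi_pmf finP) simp
  have Y: "measure_pmf.expectation ?R (?Y j m) \<le> ?S j m / real M" for j m
  proof -
    have "(\<lambda>\<pi>. (output_term L d s P (z m) j \<pi>)\<^sup>2)
        = (\<lambda>\<pi>. of_bool (\<pi> L = j) * (path_hidden L d s P (z m) (L - 1) (\<pi> (L - 1)))\<^sup>2)"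
      by (auto simp: output_term_def)
    then have "measure_pmf.expectation P (\<lambda>\<pi>. (output_term L d s P (z m) j \<pi>)\<^sup>2) = ?S j m"
      using expectation_pair_marginal[OF P L order_refl, of j "\<lambda>i. (path_hidden L d s P (z m) (L - 1) i)\<^sup>2"]
      by simp
    then show ?thesis
      using expectation_sample_mean_deviation[OF finP M, of dflt "output_term L d s P (z m) j"] M
      by (simp add: expectation_emp_pmf)
  qed
  have "measure_pmf.expectation ?R (\<lambda>\<omega>. (1 / real n) * (\<Sum>m = 1..n. \<Sum>j = 1..d L. ?Y j m \<omega>))
      = (1 / real n) * (\<Sum>m = 1..n. \<Sum>j = 1..d L. measure_pmf.expectation ?R (?Y j m))"
    unfolding expectation_mean[OF finR]
    by (subst Bochner_Integration.integral_sum) (intro integrable_measure_pmf_finite finR, rule refl)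
  also have "\<dots> \<le> (1 / real n) * (\<Sum>m = 1..n. \<Sum>j = 1..d L. ?S j m / real M)"
    by (intro mult_left_mono sum_mono Y) simp
  also have "\<dots> = (\<Sum>j = 1..d L. (1 / real n) * (\<Sum>m = 1..n. ?S j m)) / real M"
    by (subst sum.swap) (simp only: sum_divide_distrib sum_distrib_left times_divide_eq_right)
  also have "\<dots> \<le> (\<Sum>j = 1..d L. marginal L d (pmf P) L j) / real M"
    by (intro divide_right_mono sum_mono mean_square_pair_marginal_le[OF s z L order_refl]) auto
  also have "\<dots> = 1 / real M"
    by (simp add: sum_marginal[OF P order_refl, unfolded One_nat_def])
  finally show ?thesis by (simp add: L2_set_def sum_nonneg)
qed

theorem theorem3p2:
  fixes L n M :: nat
    and d :: "nat \<Rightarrow> nat"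
    and W :: "nat \<Rightarrow> nat \<Rightarrow> nat \<Rightarrow> real"
    and s :: "nat \<Rightarrow> nat \<Rightarrow> real"
    and x :: "nat \<Rightarrow> nat \<Rightarrow> real"
    and q :: real
  assumes "1 \<le> L" and "1 \<le> n" and "1 \<le> M" and "1 \<le> q" and "q \<le> 2"
    and "\<forall>l\<in>{1..L}. \<forall>j\<in>{1..d l}. \<forall>i\<in>{1..d (l - 1)}. 0 \<le> W l j i"
    and "\<forall>l\<in>{1..<L}. \<forall>j\<in>{1..d l}. s l j = 1 \<or> s l j = - 1"
    and "0 < path_variation L d W q n x"
  shows
    "measure_pmf.expectation (path_samples L d W q n x M)
      (\<lambda>\<omega>. (1 / real n) * (\<Sum>m = 1..n.
        (L2_set (\<lambda>j. path_variation L d W q n x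
                       * dist_network L d s (input_weight q n x) (emp_markov L d M \<omega>) (x m) j
                     - network L d s W (x m) j) {1..d L})\<^sup>2))
     \<le> (path_variation L d W q n x * path_complexity L d W q n x * real L / sqrt (real M))\<^sup>2"
proof -
  let ?V = "path_variation L d W q n x" and ?u = "input_weight q n x"
  let ?P = "path_pmf L d W q n x"
  let ?p = "marginal L d (pmf ?P)"
  let ?z = "\<lambda>m i. x m i / ?u i"
  let ?R = "path_samples L d W q n x M"
  let ?D = "\<lambda>l j \<omega> m. ?V * measure_pmf.expectation (emp_pmf M \<omega>) (hidden_dev L d s ?P (?z m) l j)"
  let ?G = "\<lambda>\<omega> m. ?V * L2_set (\<lambda>j. measure_pmf.expectation (emp_pmf M \<omega>) (output_term L d s ?P (?z m) j)
          - measure_pmf.expectation ?P (output_term L d s ?P (?z m) j)) {1..d L}"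
  let ?J = "Sigma {1..L - 1} (\<lambda>l. {1..d l})"
  have pmf: "pmf ?P = path_prob L d W q n x"
    using pmf_path_pmf[OF assms(2,6,8)] by auto
  have P: "set_pmf ?P \<subseteq> paths L d"
    by (auto simp: set_pmf_eq pmf path_prob_def)
  have finR: "finite (set_pmf ?R)"
    unfolding path_samples_def using P finite_paths
    by (intro finite_set_Pi_pmf finite_subset[OF P]) auto
  have \<omega>: "\<omega> k \<in> paths L d" if "\<omega> \<in> set_pmf ?R" "k \<in> {1..M}" for \<omega> k
    using that P by (auto simp: path_samples_def set_Pi_pmf PiE_dflt_def)
  have s: "\<bar>s l j\<bar> = 1" if "l \<in> {1..<L}" "j \<in> {1..d l}" for l j
    using assms(7) that by fastforce
  have z: "(1 / real n) * (\<Sum>m = 1..n. (?z m i)\<^sup>2) \<le> 1" for i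
    using assms(2,4,5) by (rule mean_square_normalized_input_le_1)
  \<comment> \<open>Renormalisation by the path law, with constant \<open>?V\<close> and the input
    weights of the dataset.\<close>
  have net: "network L d s W (x m) j = ?V * path_network L d s ?P (?z m) j"
    if "m \<in> {1..n}" "j \<in> {1..d L}" for m j
  proof (rule network_dist_weights[OF assms(1,6), symmetric])
    show "?u i = 0 \<Longrightarrow> x m i = 0" for i
      using input_weight_eq_0[OF assms(4) that(1)] .
  qed (use assms that in \<open>auto simp: pmf path_prob_def input_weight_nonneg\<close>)
  \<comment> \<open>A bound for each single sample and data point, with one term per hidden unit;
    the expectation over samples enters only afterwards.\<close>
  have X: "\<bar>L2_set (\<lambda>j. ?V * dist_network L d s ?u (emp_markov L d M \<omega>) (x m) j
        - network L d s W (x m) j) {1..d L}\<bar>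
      \<le> (\<Sum>(l, j)\<in>?J. \<bar>?D l j \<omega> m\<bar>) + \<bar>?G \<omega> m\<bar>"
    if \<omega>R: "\<omega> \<in> set_pmf ?R" and m: "m \<in> {1..n}" for \<omega> m
  proof -
    have Q: "set_pmf (emp_pmf M \<omega>) \<subseteq> paths L d"
      using \<omega>[OF \<omega>R] assms(3) by (auto simp: set_emp_pmf)
    have "L2_set (\<lambda>j. ?V * dist_network L d s ?u (emp_markov L d M \<omega>) (x m) j
          - network L d s W (x m) j) {1..d L}
        = L2_set (\<lambda>j. ?V * (path_network L d s (emp_pmf M \<omega>) (?z m) j - path_network L d s ?P (?z m) j)) {1..d L}"
      by (intro L2_set_cong refl)
        (simp only: net[OF m] dist_network_emp_markov[OF assms(1,3) \<omega>[OF \<omega>R]] right_diff_distrib)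
    also have "\<dots> = ?V * L2_set (\<lambda>j. path_network L d s (emp_pmf M \<omega>) (?z m) j - path_network L d s ?P (?z m) j) {1..d L}"
      using assms(8) by (simp add: L2_set_right_distrib)
    also have "\<dots> \<le> ?V * ((\<Sum>l = 1..L - 1. \<Sum>j = 1..d l.
          \<bar>measure_pmf.expectation (emp_pmf M \<omega>) (hidden_dev L d s ?P (?z m) l j)\<bar>)
        + L2_set (\<lambda>j. measure_pmf.expectation (emp_pmf M \<omega>) (output_term L d s ?P (?z m) j)
          - measure_pmf.expectation ?P (output_term L d s ?P (?z m) j)) {1..d L})"
      using assms(8) by (intro mult_left_mono L2_set_path_network_diff_le[OF assms(1) P Q s]) auto
    also have "\<dots> = (\<Sum>l = 1..L - 1. \<Sum>j = 1..d l. \<bar>?D l j \<omega> m\<bar>) + \<bar>?G \<omega> m\<bar>"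
      using assms(8) by (simp add: abs_mult distrib_left sum_distrib_left)
    also have "(\<Sum>l = 1..L - 1. \<Sum>j = 1..d l. \<bar>?D l j \<omega> m\<bar>) = (\<Sum>(l, j)\<in>?J. \<bar>?D l j \<omega> m\<bar>)"
      by (rule sum.Sigma) auto
    finally show ?thesis by simp
  qed
  have scale: "measure_pmf.expectation ?R (\<lambda>\<omega>. (1 / real n) * (\<Sum>m = 1..n. (?V * Y \<omega> m)\<^sup>2))
      = ?V\<^sup>2 * measure_pmf.expectation ?R (\<lambda>\<omega>. (1 / real n) * (\<Sum>m = 1..n. (Y \<omega> m)\<^sup>2))" for Y
    by (simp add: power_mult_distrib mult.left_commute flip: sum_distrib_left integral_mult_right_zero)
  \<comment> \<open>The mean squares are at most \<open>?V\<^sup>2 * ?p l j / M\<close> for a hidden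
    unit and \<open>?V\<^sup>2 / M\<close> for the output layer; Minkowski's inequality adds up the
    square roots.\<close>
  have "measure_pmf.expectation ?R (\<lambda>\<omega>. (1 / real n) * (\<Sum>m = 1..n.
        (L2_set (\<lambda>j. ?V * dist_network L d s ?u (emp_markov L d M \<omega>) (x m) j
                     - network L d s W (x m) j) {1..d L})\<^sup>2))
     \<le> ((\<Sum>a\<in>?J. ?V * sqrt (?p (fst a) (snd a) / real M)) + ?V * sqrt (1 / real M))\<^sup>2"
  proof (rule mean_square_le[OF finR, where F = "\<lambda>a. ?D (fst a) (snd a)" and G = ?G])
    fix a assume "a \<in> ?J"
    then have a: "1 \<le> fst a" "fst a \<le> L" by auto
    show "measure_pmf.expectation ?R (\<lambda>\<omega>. (1 / real n) * (\<Sum>m = 1..n. (?D (fst a) (snd a) \<omega> m)\<^sup>2))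
        \<le> (?V * sqrt (?p (fst a) (snd a) / real M))\<^sup>2"
    proof -
      have "?V\<^sup>2 * measure_pmf.expectation ?R (\<lambda>\<omega>. (1 / real n) * (\<Sum>m = 1..n.
            (measure_pmf.expectation (emp_pmf M \<omega>) (hidden_dev L d s ?P (?z m) (fst a) (snd a)))\<^sup>2))
          \<le> ?V\<^sup>2 * (?p (fst a) (snd a) / real M)"
        unfolding path_samples_def
        by (intro mult_left_mono mean_square_hidden_dev_le P assms(3) a s z) auto
      then show ?thesis
        unfolding scale by (simp add: power_mult_distrib marginal_pmf_nonneg)
    qed
  next
    show "measure_pmf.expectation ?R (\<lambda>\<omega>. (1 / real n) * (\<Sum>m = 1..n. (?G \<omega> m)\<^sup>2))
        \<le> (?V * sqrt (1 / real M))\<^sup>2"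
    proof -
      have "?V\<^sup>2 * measure_pmf.expectation ?R (\<lambda>\<omega>. (1 / real n) * (\<Sum>m = 1..n.
            (L2_set (\<lambda>j. measure_pmf.expectation (emp_pmf M \<omega>) (output_term L d s ?P (?z m) j)
              - measure_pmf.expectation ?P (output_term L d s ?P (?z m) j)) {1..d L})\<^sup>2))
          \<le> ?V\<^sup>2 * (1 / real M)"
        unfolding path_samples_def
        by (intro mult_left_mono mean_square_output_dev_le P assms(1,3) s z) auto
      then show ?thesis
        unfolding scale by (simp add: power_mult_distrib)
    qed
  qed (use X assms(8) in \<open>auto simp: case_prod_unfold marginal_pmf_nonneg\<close>)
  also have "(\<Sum>a\<in>?J. ?V * sqrt (?p (fst a) (snd a) / real M)) + ?V * sqrt (1 / real M)
      = ?V * (1 + (\<Sum>l = 1..L - 1. \<Sum>j = 1..d l. sqrt (?p l j))) / sqrt (real M)"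
    by (simp add: sum.Sigma case_prod_unfold real_sqrt_divide sum_divide_distrib sum_distrib_left
        add_divide_distrib distrib_left)
  also have "1 + (\<Sum>l = 1..L - 1. \<Sum>j = 1..d l. sqrt (?p l j)) = path_complexity L d W q n x * real L"
  proof -
    have exp_renyi: "exp (1 / 2 * renyi_half {1..d l} (?p l)) = (\<Sum>j = 1..d l. sqrt (?p l j))" if "l \<le> L" for l
    proof -
      \<comment> \<open>\<open>exp\<close> undoes \<open>ln\<close> only at a positive argument. The
        sum is positive because the marginals of a layer add up to 1.\<close>
      have "(\<Sum>j = 1..d l. sqrt (?p l j)) \<noteq> 0"
      proof
        assume "(\<Sum>j = 1..d l. sqrt (?p l j)) = 0"
        then have "\<forall>j\<in>{1..d l}. ?p l j = 0"
          by (subst (asm) sum_nonneg_eq_0_iff) (auto simp: marginal_pmf_nonneg)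
        then show False using sum_marginal[OF P that] by simp
      qed
      moreover have "0 \<le> (\<Sum>j = 1..d l. sqrt (?p l j))"
        by (simp add: sum_nonneg marginal_pmf_nonneg)
      ultimately show ?thesis by (simp add: renyi_half_def)
    qed
    have "(\<Sum>l = 1..L - 1. exp (1 / 2 * renyi_half {1..d l} (?p l)))
        = (\<Sum>l = 1..L - 1. \<Sum>j = 1..d l. sqrt (?p l j))"
      by (intro sum.cong refl exp_renyi) auto
    then have "path_complexity L d W q n x
        = (1 / real L) * (1 + (\<Sum>l = 1..L - 1. \<Sum>j = 1..d l. sqrt (?p l j)))"
      unfolding path_complexity_def pmf[symmetric] by (simp only:)
    then show ?thesis using assms(1) by simp
  qed
  finally show ?thesis by (simp only: mult.assoc)
qed

end
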